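(* Let $(\mathcal{V}, \otimes, I, a, \ell, r)$ be a left skew monoidal category and let $(\mathcal{A}, *, m, u)$ be a strong left $\mathcal{V}$-action. Suppose there exists an object $J \in \mathcal{A}$ such that the functor $J_* : \mathcal{V} \to \mathcal{A}$, $J_*X = X * J$, has a left adjoint $J_! \dashv J_*$, with unit $\eta$ and counit $\epsilon$. Then there is a left skew monoidal structure $(\mathcal{A}, \lhd, J, \gamma, \lambda, \rho)$ on $\mathcal{A}$ defined as follows. For $A, B, C \in \mathcal{A}$ put $A \lhd B = J_!A * B$ and $$\gamma_{A,B,C} : J_!(J_!A*B)*C \xrightarrow{\tilde{\gamma}_{A,B}*C} (J_!A \otimes J_!B)*C \xrightarrow{m^{J_!A, J_!B}_C} J_!A*(J_!B*C),$$ $$\lambda_A : J_!J*A \xrightarrow{J_!(u_J^{-1}) * A} J_!(I*J)*A \xrightarrow{\epsilon_I * A} I*A \xrightarrow{u_A} A,$$ $$\rho_A : A \xrightarrow{\eta_A} J_!A*J,$$ where $\tilde{\gamma}_{A,B} : J_!(J_!A*B) \to J_!A \otimes J_!B$ is the adjoint transpose under $J_! \dashv J_*$ of the composite $$J_!A*B \xrightarrow{J_!A * \eta_B} J_!A*(J_!B*J) \xrightarrow{(m^{J_!A, J_!B}_J)^{-1}} (J_!A \otimes J_!B)*J .$$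
   Context: A left skew monoidal category $(\mathcal{A}, \otimes, I, \gamma,\lambda,\rho)$ consists of a category $\mathcal{A}$, a functor $\otimes : \mathcal{A}\times\mathcal{A}\to\mathcal{A}$, an object $I$, and natural families of (not necessarily invertible) morphisms $\gamma_{A,B,C} : (A\otimes B)\otimes C \to A\otimes(B\otimes C)$ (associator), $\lambda_A : I\otimes A\to A$ (left unitor), $\rho_A : A\to A\otimes I$ (right unitor) such that for all objects: (1) $(A\otimes\gamma_{B,C,D})\circ\gamma_{A,B\otimes C,D}\circ(\gamma_{A,B,C}\otimes D)=\gamma_{A,B,C\otimes D}\circ\gamma_{A\otimes B,C,D}$; (2) $\gamma_{A,B,I}\circ\rho_{A\otimes B}=A\otimes\rho_B$; (3) $\lambda_{A\otimes B}\circ\gamma_{I,A,B}=\lambda_A\otimes B$; (4) $\lambda_I\circ\rho_I=\mathrm{id}_I$; (5) $(A\otimes\lambda_B)\circ\gamma_{A,I,B}\circ(\rho_A\otimes B)=\mathrm{id}_{A\otimes B}$. Let $(\mathcal{V},\otimes,I,a,\ell,r)$ be a left skew monoidal category (associator $a$, left unitor $\ell$, right unitor $r$) and $\mathcal{A}$ an ordinary category. A strong left action of $\mathcal{V}$ on $\mathcal{A}$ is a bifunctor $* : \mathcal{V}\times\mathcal{A}\to\mathcal{A}$ together with natural families of isomorphisms $m^{X,Y}_A : (X\otimes Y)*A\to X*(Y*A)$ and $u_A : I*A\to A$ such that $(X*m^{Y,Z}_A)\circ m^{X,Y\otimes Z}_A\circ(a_{X,Y,Z}*A)=m^{X,Y}_{Z*A}\circ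 m^{X\otimes Y,Z}_A$; $u_{X*A}\circ m^{I,X}_A=\ell_X*A$; $(X*u_A)\circ m^{X,I}_A\circ(r_X*A)=\mathrm{id}_{X*A}$. One then says $(\mathcal{A},*,m,u)$ is a strong left $\mathcal{V}$-action (or $\mathcal{A}$ is a strong left $\mathcal{V}$-actegory). *)

theory Defs
  imports Main
begin

section \<open>Categories, functors, natural transformations\<close>

text \<open>
  Objects and arrows are carried by sets inside arbitrary types; every arrow has one domain and
  one codomain, so hom-sets are disjoint. \<open>Dom\<close>, \<open>Cod\<close>, \<open>Idn\<close> and \<open>Comp\<close> are unconstrained off
  the carriers (and \<open>Comp\<close> on non-composable pairs).
\<close>

record ('o, 'm) cat =
  Obj :: "'o set"
  Arr :: "'m set"
  Dom :: "'m \<Rightarrow> 'o"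
  Cod :: "'m \<Rightarrow> 'o"
  Idn :: "'o \<Rightarrow> 'm"
  Comp :: "'m \<Rightarrow> 'm \<Rightarrow> 'm" (infixr "\<cdot>\<index>" 65)

definition Hom :: "('o, 'm) cat \<Rightarrow> 'o \<Rightarrow> 'o \<Rightarrow> 'm set" where
  "Hom C X Y = {f \<in> Arr C. Dom C f = X \<and> Cod C f = Y}"

locale category =
  fixes C :: "('o, 'm) cat"
  assumes Dom_Obj: "f \<in> Arr C \<Longrightarrow> Dom C f \<in> Obj C"
    and Cod_Obj: "f \<in> Arr C \<Longrightarrow> Cod C f \<in> Obj C"
    and Idn_Hom: "X \<in> Obj C \<Longrightarrow> Idn C X \<in> Hom C X X"
    and Comp_Hom: "f \<in> Hom C X Y \<Longrightarrow> g \<in> Hom C Y Z \<Longrightarrow> g \<cdot>\<^bsub>C\<^esub> f \<in> Hom C X Z"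
    and Idn_right: "f \<in> Hom C X Y \<Longrightarrow> f \<cdot>\<^bsub>C\<^esub> Idn C X = f"
    and Idn_left: "f \<in> Hom C X Y \<Longrightarrow> Idn C Y \<cdot>\<^bsub>C\<^esub> f = f"
    and Comp_assoc: "f \<in> Hom C W X \<Longrightarrow> g \<in> Hom C X Y \<Longrightarrow> h \<in> Hom C Y Z \<Longrightarrow>
          (h \<cdot>\<^bsub>C\<^esub> g) \<cdot>\<^bsub>C\<^esub> f = h \<cdot>\<^bsub>C\<^esub> (g \<cdot>\<^bsub>C\<^esub> f)"

definition inverse_arrows :: "('o, 'm) cat \<Rightarrow> 'm \<Rightarrow> 'm \<Rightarrow> bool" where
  "inverse_arrows C f g \<longleftrightarrow>
     f \<in> Arr C \<and> g \<in> Hom C (Cod C f) (Dom C f) \<and>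
     g \<cdot>\<^bsub>C\<^esub> f = Idn C (Dom C f) \<and> f \<cdot>\<^bsub>C\<^esub> g = Idn C (Cod C f)"

definition iso_arrow :: "('o, 'm) cat \<Rightarrow> 'm \<Rightarrow> bool" where
  "iso_arrow C f \<longleftrightarrow> (\<exists>g. inverse_arrows C f g)"

definition inv_arrow :: "('o, 'm) cat \<Rightarrow> 'm \<Rightarrow> 'm" where
  "inv_arrow C f = (THE g. inverse_arrows C f g)"

definition prod_cat :: "('o1, 'm1) cat \<Rightarrow> ('o2, 'm2) cat \<Rightarrow> ('o1 \<times> 'o2, 'm1 \<times> 'm2) cat" where
  "prod_cat C D =
     \<lparr> Obj = Obj C \<times> Obj D,
       Arr = Arr C \<times> Arr D,
       Dom = (\<lambda>(f, g). (Dom C f, Dom D g)),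
       Cod = (\<lambda>(f, g). (Cod C f, Cod D g)),
       Idn = (\<lambda>(X, Y). (Idn C X, Idn D Y)),
       Comp = (\<lambda>(f', g') (f, g). (f' \<cdot>\<^bsub>C\<^esub> f, g' \<cdot>\<^bsub>D\<^esub> g)) \<rparr>"

record ('o1, 'm1, 'o2, 'm2) fctr =
  omap :: "'o1 \<Rightarrow> 'o2"
  amap :: "'m1 \<Rightarrow> 'm2"

locale is_functor = src: category C + tgt: category D
  for C :: "('o1, 'm1) cat" and D :: "('o2, 'm2) cat" +
  fixes F :: "('o1, 'm1, 'o2, 'm2) fctr"
  assumes omap_Obj: "X \<in> Obj C \<Longrightarrow> omap F X \<in> Obj D"
    and amap_Hom: "f \<in> Hom C X Y \<Longrightarrow> amap F f \<in> Hom D (omap F X) (omap F Y)"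
    and amap_Idn: "X \<in> Obj C \<Longrightarrow> amap F (Idn C X) = Idn D (omap F X)"
    and amap_Comp: "f \<in> Hom C X Y \<Longrightarrow> g \<in> Hom C Y Z \<Longrightarrow>
          amap F (g \<cdot>\<^bsub>C\<^esub> f) = amap F g \<cdot>\<^bsub>D\<^esub> amap F f"

definition id_functor :: "('o, 'm, 'o, 'm) fctr" where
  "id_functor = \<lparr> omap = (\<lambda>X. X), amap = (\<lambda>f. f) \<rparr>"

definition comp_functor ::
  "('o2, 'm2, 'o3, 'm3) fctr \<Rightarrow> ('o1, 'm1, 'o2, 'm2) fctr \<Rightarrow> ('o1, 'm1, 'o3, 'm3) fctr" where
  "comp_functor G F = \<lparr> omap = (\<lambda>X. omap G (omap F X)), amap = (\<lambda>f. amap G (amap F f)) \<rparr>"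

locale nat_trans = F: is_functor C D F + G: is_functor C D G
  for C :: "('o1, 'm1) cat" and D :: "('o2, 'm2) cat"
    and F G :: "('o1, 'm1, 'o2, 'm2) fctr" +
  fixes t :: "'o1 \<Rightarrow> 'm2"
  assumes component: "X \<in> Obj C \<Longrightarrow> t X \<in> Hom D (omap F X) (omap G X)"
    and natural: "f \<in> Hom C X Y \<Longrightarrow> t Y \<cdot>\<^bsub>D\<^esub> amap F f = amap G f \<cdot>\<^bsub>D\<^esub> t X"

text \<open>The adjunction \<open>L \<stileturn> R\<close> with \<open>L : C \<rightarrow> D\<close>, unit \<open>\<eta>\<close> and counit \<open>\<epsilon>\<close>.\<close>

locale adjunction =
  unit: nat_trans C C id_functor "comp_functor R L" \<eta> +
  counit: nat_trans D D "comp_functor L R" id_functor \<epsilon> +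
  L: is_functor C D L + R: is_functor D C R
  for C :: "('o1, 'm1) cat" and D :: "('o2, 'm2) cat"
    and L :: "('o1, 'm1, 'o2, 'm2) fctr" and R :: "('o2, 'm2, 'o1, 'm1) fctr"
    and \<eta> :: "'o1 \<Rightarrow> 'm1" and \<epsilon> :: "'o2 \<Rightarrow> 'm2" +
  assumes triangle_L: "X \<in> Obj C \<Longrightarrow> \<epsilon> (omap L X) \<cdot>\<^bsub>D\<^esub> amap L (\<eta> X) = Idn D (omap L X)"
    and triangle_R: "Y \<in> Obj D \<Longrightarrow> amap R (\<epsilon> Y) \<cdot>\<^bsub>C\<^esub> \<eta> (omap R Y) = Idn C (omap R Y)"

text \<open>The transpose \<open>L X \<rightarrow> Y\<close> of an arrow \<open>f : X \<rightarrow> R Y\<close>.\<close>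

definition transpose ::
  "('o2, 'm2) cat \<Rightarrow> ('o1, 'm1, 'o2, 'm2) fctr \<Rightarrow> ('o2 \<Rightarrow> 'm2) \<Rightarrow> 'o2 \<Rightarrow> 'm1 \<Rightarrow> 'm2" where
  "transpose D L \<epsilon> Y f = \<epsilon> Y \<cdot>\<^bsub>D\<^esub> amap L f"

section \<open>Skew monoidal categories and strong actions\<close>

text \<open>
  A bifunctor is a functor \<open>T\<close> on a product category. Its value on a pair of objects is written
  \<open>X \<otimes>\<^bsub>T\<^esub> Y\<close>, its value on a pair of arrows \<open>f \<boxtimes>\<^bsub>T\<^esub> g\<close>; whiskerings
  such as \<open>X \<otimes> g\<close> are written with an explicit identity arrow.
\<close>

abbreviation bifun_obj ::
  "('o1 \<times> 'o2, 'm1 \<times> 'm2, 'o3, 'm3) fctr \<Rightarrow> 'o1 \<Rightarrow> 'o2 \<Rightarrow> 'o3" (infixr "\<otimes>\<index>" 75) where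
  "X \<otimes>\<^bsub>T\<^esub> Y \<equiv> omap T (X, Y)"

abbreviation bifun_arr ::
  "('o1 \<times> 'o2, 'm1 \<times> 'm2, 'o3, 'm3) fctr \<Rightarrow> 'm1 \<Rightarrow> 'm2 \<Rightarrow> 'm3" (infixr "\<boxtimes>\<index>" 75) where
  "f \<boxtimes>\<^bsub>T\<^esub> g \<equiv> amap T (f, g)"

locale left_skew_monoidal =
  category C + tensor: is_functor "prod_cat C C" C T
  for C :: "('o, 'm) cat" and T :: "('o \<times> 'o, 'm \<times> 'm, 'o, 'm) fctr" +
  fixes I :: 'o
    and \<gamma> :: "'o \<Rightarrow> 'o \<Rightarrow> 'o \<Rightarrow> 'm"
    and lu :: "'o \<Rightarrow> 'm"
    and ru :: "'o \<Rightarrow> 'm"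
  assumes unit_Obj: "I \<in> Obj C"
    and assoc_Hom: "X \<in> Obj C \<Longrightarrow> Y \<in> Obj C \<Longrightarrow> Z \<in> Obj C \<Longrightarrow>
          \<gamma> X Y Z \<in> Hom C ((X \<otimes>\<^bsub>T\<^esub> Y) \<otimes>\<^bsub>T\<^esub> Z) (X \<otimes>\<^bsub>T\<^esub> (Y \<otimes>\<^bsub>T\<^esub> Z))"
    and assoc_natural: "f \<in> Hom C X X' \<Longrightarrow> g \<in> Hom C Y Y' \<Longrightarrow> h \<in> Hom C Z Z' \<Longrightarrow>
          \<gamma> X' Y' Z' \<cdot>\<^bsub>C\<^esub> ((f \<boxtimes>\<^bsub>T\<^esub> g) \<boxtimes>\<^bsub>T\<^esub> h) = (f \<boxtimes>\<^bsub>T\<^esub> (g \<boxtimes>\<^bsub>T\<^esub> h)) \<cdot>\<^bsub>C\<^esub> \<gamma> X Y Z"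
    and lunit_Hom: "X \<in> Obj C \<Longrightarrow> lu X \<in> Hom C (I \<otimes>\<^bsub>T\<^esub> X) X"
    and lunit_natural: "f \<in> Hom C X Y \<Longrightarrow> lu Y \<cdot>\<^bsub>C\<^esub> (Idn C I \<boxtimes>\<^bsub>T\<^esub> f) = f \<cdot>\<^bsub>C\<^esub> lu X"
    and runit_Hom: "X \<in> Obj C \<Longrightarrow> ru X \<in> Hom C X (X \<otimes>\<^bsub>T\<^esub> I)"
    and runit_natural: "f \<in> Hom C X Y \<Longrightarrow> ru Y \<cdot>\<^bsub>C\<^esub> f = (f \<boxtimes>\<^bsub>T\<^esub> Idn C I) \<cdot>\<^bsub>C\<^esub> ru X"
    and skew_pentagon: "W \<in> Obj C \<Longrightarrow> X \<in> Obj C \<Longrightarrow> Y \<in> Obj C \<Longrightarrow> Z \<in> Obj C \<Longrightarrow>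
          (Idn C W \<boxtimes>\<^bsub>T\<^esub> \<gamma> X Y Z) \<cdot>\<^bsub>C\<^esub> \<gamma> W (X \<otimes>\<^bsub>T\<^esub> Y) Z \<cdot>\<^bsub>C\<^esub> (\<gamma> W X Y \<boxtimes>\<^bsub>T\<^esub> Idn C Z)
          = \<gamma> W X (Y \<otimes>\<^bsub>T\<^esub> Z) \<cdot>\<^bsub>C\<^esub> \<gamma> (W \<otimes>\<^bsub>T\<^esub> X) Y Z"
    and skew_runit: "X \<in> Obj C \<Longrightarrow> Y \<in> Obj C \<Longrightarrow>
          \<gamma> X Y I \<cdot>\<^bsub>C\<^esub> ru (X \<otimes>\<^bsub>T\<^esub> Y) = Idn C X \<boxtimes>\<^bsub>T\<^esub> ru Y"
    and skew_lunit: "X \<in> Obj C \<Longrightarrow> Y \<in> Obj C \<Longrightarrow>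
          lu (X \<otimes>\<^bsub>T\<^esub> Y) \<cdot>\<^bsub>C\<^esub> \<gamma> I X Y = lu X \<boxtimes>\<^bsub>T\<^esub> Idn C Y"
    and skew_unit: "lu I \<cdot>\<^bsub>C\<^esub> ru I = Idn C I"
    and skew_triangle: "X \<in> Obj C \<Longrightarrow> Y \<in> Obj C \<Longrightarrow>
          (Idn C X \<boxtimes>\<^bsub>T\<^esub> lu Y) \<cdot>\<^bsub>C\<^esub> \<gamma> X I Y \<cdot>\<^bsub>C\<^esub> (ru X \<boxtimes>\<^bsub>T\<^esub> Idn C Y) = Idn C (X \<otimes>\<^bsub>T\<^esub> Y)"

locale strong_left_action =
  left_skew_monoidal V T I a l r + act: category A + act: is_functor "prod_cat V A" A S
  for V :: "('v, 'n) cat" and T :: "('v \<times> 'v, 'n \<times> 'n, 'v, 'n) fctr" and I :: 'v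
    and a :: "'v \<Rightarrow> 'v \<Rightarrow> 'v \<Rightarrow> 'n" and l r :: "'v \<Rightarrow> 'n"
    and A :: "('o, 'm) cat" and S :: "('v \<times> 'o, 'n \<times> 'm, 'o, 'm) fctr" +
  fixes m :: "'v \<Rightarrow> 'v \<Rightarrow> 'o \<Rightarrow> 'm"
    and u :: "'o \<Rightarrow> 'm"
  assumes mult_Hom: "X \<in> Obj V \<Longrightarrow> Y \<in> Obj V \<Longrightarrow> B \<in> Obj A \<Longrightarrow>
          m X Y B \<in> Hom A ((X \<otimes>\<^bsub>T\<^esub> Y) \<otimes>\<^bsub>S\<^esub> B) (X \<otimes>\<^bsub>S\<^esub> (Y \<otimes>\<^bsub>S\<^esub> B))"
    and mult_iso: "X \<in> Obj V \<Longrightarrow> Y \<in> Obj V \<Longrightarrow> B \<in> Obj A \<Longrightarrow> iso_arrow A (m X Y B)"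
    and mult_natural: "f \<in> Hom V X X' \<Longrightarrow> g \<in> Hom V Y Y' \<Longrightarrow> h \<in> Hom A B B' \<Longrightarrow>
          m X' Y' B' \<cdot>\<^bsub>A\<^esub> ((f \<boxtimes>\<^bsub>T\<^esub> g) \<boxtimes>\<^bsub>S\<^esub> h) = (f \<boxtimes>\<^bsub>S\<^esub> (g \<boxtimes>\<^bsub>S\<^esub> h)) \<cdot>\<^bsub>A\<^esub> m X Y B"
    and unit_Hom: "B \<in> Obj A \<Longrightarrow> u B \<in> Hom A (I \<otimes>\<^bsub>S\<^esub> B) B"
    and unit_iso: "B \<in> Obj A \<Longrightarrow> iso_arrow A (u B)"
    and unit_natural: "h \<in> Hom A B B' \<Longrightarrow> u B' \<cdot>\<^bsub>A\<^esub> (Idn V I \<boxtimes>\<^bsub>S\<^esub> h) = h \<cdot>\<^bsub>A\<^esub> u B"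
    and act_pentagon: "X \<in> Obj V \<Longrightarrow> Y \<in> Obj V \<Longrightarrow> Z \<in> Obj V \<Longrightarrow> B \<in> Obj A \<Longrightarrow>
          (Idn V X \<boxtimes>\<^bsub>S\<^esub> m Y Z B) \<cdot>\<^bsub>A\<^esub> m X (Y \<otimes>\<^bsub>T\<^esub> Z) B \<cdot>\<^bsub>A\<^esub> (a X Y Z \<boxtimes>\<^bsub>S\<^esub> Idn A B)
          = m X Y (Z \<otimes>\<^bsub>S\<^esub> B) \<cdot>\<^bsub>A\<^esub> m (X \<otimes>\<^bsub>T\<^esub> Y) Z B"
    and act_lunit: "X \<in> Obj V \<Longrightarrow> B \<in> Obj A \<Longrightarrow>
          u (X \<otimes>\<^bsub>S\<^esub> B) \<cdot>\<^bsub>A\<^esub> m I X B = l X \<boxtimes>\<^bsub>S\<^esub> Idn A B"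
    and act_triangle: "X \<in> Obj V \<Longrightarrow> B \<in> Obj A \<Longrightarrow>
          (Idn V X \<boxtimes>\<^bsub>S\<^esub> u B) \<cdot>\<^bsub>A\<^esub> m X I B \<cdot>\<^bsub>A\<^esub> (r X \<boxtimes>\<^bsub>S\<^esub> Idn A B) = Idn A (X \<otimes>\<^bsub>S\<^esub> B)"

section \<open>The induced structure\<close>

text \<open>
  In what follows \<open>S\<close> is the action bifunctor of \<open>V\<close> on \<open>A\<close>, \<open>act_on A S J\<close> is the functor
  \<open>J\<^sub>* = (- * J)\<close>, and \<open>L\<close> is its left adjoint \<open>J\<^sub>!\<close>.
\<close>

definition act_on ::
  "('o, 'm) cat \<Rightarrow> ('v \<times> 'o, 'n \<times> 'm, 'o, 'm) fctr \<Rightarrow> 'o \<Rightarrow> ('v, 'n, 'o, 'm) fctr" where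
  "act_on A S J = \<lparr> omap = (\<lambda>X. X \<otimes>\<^bsub>S\<^esub> J), amap = (\<lambda>f. f \<boxtimes>\<^bsub>S\<^esub> Idn A J) \<rparr>"

definition ind_tensor ::
  "('v \<times> 'o, 'n \<times> 'm, 'o, 'm) fctr \<Rightarrow> ('o, 'm, 'v, 'n) fctr \<Rightarrow> ('o \<times> 'o, 'm \<times> 'm, 'o, 'm) fctr"
  where
  "ind_tensor S L =
     \<lparr> omap = (\<lambda>(B, C). omap L B \<otimes>\<^bsub>S\<^esub> C), amap = (\<lambda>(f, g). amap L f \<boxtimes>\<^bsub>S\<^esub> g) \<rparr>"

definition ind_assoc_tilde ::
  "('v, 'n) cat \<Rightarrow> ('v \<times> 'v, 'n \<times> 'n, 'v, 'n) fctr \<Rightarrow>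
   ('o, 'm) cat \<Rightarrow> ('v \<times> 'o, 'n \<times> 'm, 'o, 'm) fctr \<Rightarrow> ('v \<Rightarrow> 'v \<Rightarrow> 'o \<Rightarrow> 'm) \<Rightarrow>
   'o \<Rightarrow> ('o, 'm, 'v, 'n) fctr \<Rightarrow> ('o \<Rightarrow> 'm) \<Rightarrow> ('v \<Rightarrow> 'n) \<Rightarrow> 'o \<Rightarrow> 'o \<Rightarrow> 'n" where
  "ind_assoc_tilde V T A S m J L \<eta> \<epsilon> B C =
     transpose V L \<epsilon> (omap L B \<otimes>\<^bsub>T\<^esub> omap L C)
       (inv_arrow A (m (omap L B) (omap L C) J) \<cdot>\<^bsub>A\<^esub> (Idn V (omap L B) \<boxtimes>\<^bsub>S\<^esub> \<eta> C))"

definition ind_assoc ::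
  "('v, 'n) cat \<Rightarrow> ('v \<times> 'v, 'n \<times> 'n, 'v, 'n) fctr \<Rightarrow>
   ('o, 'm) cat \<Rightarrow> ('v \<times> 'o, 'n \<times> 'm, 'o, 'm) fctr \<Rightarrow> ('v \<Rightarrow> 'v \<Rightarrow> 'o \<Rightarrow> 'm) \<Rightarrow>
   'o \<Rightarrow> ('o, 'm, 'v, 'n) fctr \<Rightarrow> ('o \<Rightarrow> 'm) \<Rightarrow> ('v \<Rightarrow> 'n) \<Rightarrow> 'o \<Rightarrow> 'o \<Rightarrow> 'o \<Rightarrow> 'm" where
  "ind_assoc V T A S m J L \<eta> \<epsilon> B C D =
     m (omap L B) (omap L C) D \<cdot>\<^bsub>A\<^esub> (ind_assoc_tilde V T A S m J L \<eta> \<epsilon> B C \<boxtimes>\<^bsub>S\<^esub> Idn A D)"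

definition ind_lunit ::
  "'v \<Rightarrow> ('o, 'm) cat \<Rightarrow> ('v \<times> 'o, 'n \<times> 'm, 'o, 'm) fctr \<Rightarrow> ('o \<Rightarrow> 'm) \<Rightarrow>
   'o \<Rightarrow> ('o, 'm, 'v, 'n) fctr \<Rightarrow> ('v \<Rightarrow> 'n) \<Rightarrow> 'o \<Rightarrow> 'm" where
  "ind_lunit I A S u J L \<epsilon> B =
     u B \<cdot>\<^bsub>A\<^esub> (\<epsilon> I \<boxtimes>\<^bsub>S\<^esub> Idn A B) \<cdot>\<^bsub>A\<^esub> (amap L (inv_arrow A (u J)) \<boxtimes>\<^bsub>S\<^esub> Idn A B)"

end

theory Submission
  imports Defs
begin

text \<open>
  Write \<open>X * B\<close> for the action, \<open>B \<lhd> C = L B * C\<close> for the induced tensor product, \<open>\<lambda>\<close> for its left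
  unitor, and \<open>\<gamma>\<^sub>0\<close> for the arrow \<open>L (L B * C) \<rightarrow> L B \<otimes> L C\<close> that underlies the
  associator \<open>\<gamma>\<close>; let \<open>\<epsilon>\<^sub>0 : L J \<rightarrow> I\<close> be the transpose of \<open>(u J)\<^sup>-\<^sup>1\<close>. The idea is that \<open>\<gamma>\<^sub>0\<close> and \<open>\<epsilon>\<^sub>0\<close>
  are the structure arrows of an opmonoidal functor: although \<open>\<lhd>\<close> is not yet known to be skew
  monoidal, the left adjoint \<open>L\<close> already satisfies in \<open>V\<close> the three coherence equations that relate
  \<open>L \<gamma>\<close>, \<open>L \<lambda>\<close>, \<open>L \<eta>\<close> to \<open>a\<close>, \<open>l\<close>, \<open>r\<close> (lemmas \<open>opmonoidal_assoc\<close>, \<open>opmonoidal_lunit\<close>,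
  \<open>opmonoidal_runit\<close>).

  Given these, the pentagon, the left unit law and the triangle for \<open>\<lhd>\<close> arise by letting both sides
  act on an object, moving \<open>m\<close> and \<open>u\<close> past the other arrows by naturality, and replacing
  \<open>a\<close>, \<open>l\<close>, \<open>r\<close> by means of the matching axiom of the action. The remaining two laws are
  the descriptions of \<open>\<gamma>\<^sub>0\<close> and \<open>\<epsilon>\<^sub>0\<close> as transposes.

  Each opmonoidal equation compares two arrows out of an object \<open>L B\<close>, so it may be checked after
  applying \<open>- * J\<close> and precomposing with \<open>\<eta> B\<close> (lemma \<open>orbit_detects\<close>). There the equation
  \<open>m \<cdot> (\<gamma>\<^sub>0 * J) \<cdot> \<eta> = L B * \<eta> C\<close> (lemma \<open>ind_assoc_tilde_eta\<close>) eliminates \<open>\<gamma>\<^sub>0\<close>, and the axioms of the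
  action at the object \<open>J\<close> do the rest.
\<close>

section \<open>Composition with side conditions on domains and codomains\<close>

text \<open>
  Rules with premises in \<open>Hom\<close> mention source and target objects that do not occur in their
  conclusions, which makes them unsuitable as rewrite rules. Restated with \<open>Arr\<close>, \<open>Dom\<close> and \<open>Cod\<close>, they
  turn type checking of composites into rewriting, and composites are kept nested to the right.
\<close>

lemma Hom_iff: "f \<in> Hom C X Y \<longleftrightarrow> f \<in> Arr C \<and> Dom C f = X \<and> Cod C f = Y"
  by (simp add: Hom_def)

context category
begin

lemma Idn_simps [simp]:
  assumes "X \<in> Obj C"
  shows "Idn C X \<in> Arr C" "Dom C (Idn C X) = X" "Cod C (Idn C X) = X"
  using Idn_Hom[OF assms] by (simp_all add: Hom_iff)

lemma Comp_simps [simp]: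
  assumes "f \<in> Arr C" "g \<in> Arr C" "Dom C g = Cod C f"
  shows "g \<cdot>\<^bsub>C\<^esub> f \<in> Arr C" "Dom C (g \<cdot>\<^bsub>C\<^esub> f) = Dom C f" "Cod C (g \<cdot>\<^bsub>C\<^esub> f) = Cod C g"
  using Comp_Hom[of f "Dom C f" "Cod C f" g "Cod C g"] assms by (simp_all add: Hom_iff)

lemma Comp_Idn [simp]:
  assumes "f \<in> Arr C"
  shows "Dom C f = X \<Longrightarrow> f \<cdot>\<^bsub>C\<^esub> Idn C X = f" "Cod C f = Y \<Longrightarrow> Idn C Y \<cdot>\<^bsub>C\<^esub> f = f"
  using assms Idn_right[of f "Dom C f" "Cod C f"] Idn_left[of f "Dom C f" "Cod C f"]
  by (simp_all add: Hom_iff)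

lemma Comp_reassoc [simp]:
  assumes "f \<in> Arr C" "g \<in> Arr C" "h \<in> Arr C" "Dom C g = Cod C f" "Dom C h = Cod C g"
  shows "(h \<cdot>\<^bsub>C\<^esub> g) \<cdot>\<^bsub>C\<^esub> f = h \<cdot>\<^bsub>C\<^esub> g \<cdot>\<^bsub>C\<^esub> f"
  using Comp_assoc[of f "Dom C f" "Cod C f" g "Cod C g" h "Cod C h"] assms by (simp add: Hom_iff)

text \<open>
  Inside a longer composite nested to the right, \<open>g \<cdot> f\<close> is not a subterm, so an equation for it has
  to be extended by a tail \<open>t\<close> before it can rewrite there.
\<close>

lemma Comp_eq_extend:
  assumes "g \<cdot>\<^bsub>C\<^esub> f = k" "f \<in> Arr C" "g \<in> Arr C" "t \<in> Arr C" "Dom C g = Cod C f" "Dom C f = Cod C t"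
  shows "g \<cdot>\<^bsub>C\<^esub> f \<cdot>\<^bsub>C\<^esub> t = k \<cdot>\<^bsub>C\<^esub> t"
  using Comp_reassoc[of t f g] assms by simp

lemma inv_arrow_inverse:
  assumes "iso_arrow C f"
  shows "inverse_arrows C f (inv_arrow C f)"
proof -
  have unique: "g = h" if g: "inverse_arrows C f g" and h: "inverse_arrows C f h" for g h
  proof -
    have "g = g \<cdot>\<^bsub>C\<^esub> f \<cdot>\<^bsub>C\<^esub> h" using g h by (simp add: inverse_arrows_def Hom_iff)
    also have "\<dots> = (g \<cdot>\<^bsub>C\<^esub> f) \<cdot>\<^bsub>C\<^esub> h" using g h by (subst Comp_reassoc) (simp_all add: inverse_arrows_def Hom_iff)
    also have "\<dots> = h" using g h by (simp add: inverse_arrows_def Hom_iff)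
    finally show ?thesis .
  qed
  from assms obtain g where "inverse_arrows C f g" by (auto simp: iso_arrow_def)
  then show ?thesis unfolding inv_arrow_def by (rule theI[where a = g]) (auto intro: unique \<open>inverse_arrows C f g\<close>)
qed

lemma inv_arrow_simps [simp]:
  assumes "iso_arrow C f"
  shows "inv_arrow C f \<in> Arr C" "Dom C (inv_arrow C f) = Cod C f" "Cod C (inv_arrow C f) = Dom C f"
    "inv_arrow C f \<cdot>\<^bsub>C\<^esub> f = Idn C (Dom C f)" "f \<cdot>\<^bsub>C\<^esub> inv_arrow C f = Idn C (Cod C f)"
  using inv_arrow_inverse[OF assms] by (simp_all add: inverse_arrows_def Hom_iff)

lemma iso_cancel_left:
  assumes iso: "iso_arrow C h"
    and eq: "h \<cdot>\<^bsub>C\<^esub> f = h \<cdot>\<^bsub>C\<^esub> g"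
    and "f \<in> Arr C" "g \<in> Arr C" "Cod C f = Dom C h" "Cod C g = Dom C h"
  shows "f = g"
proof -
  have h: "h \<in> Arr C" using iso by (auto simp: iso_arrow_def inverse_arrows_def)
  have "inv_arrow C h \<cdot>\<^bsub>C\<^esub> h \<cdot>\<^bsub>C\<^esub> k = k" if "k \<in> Arr C" "Cod C k = Dom C h" for k
    using Comp_reassoc[of k h "inv_arrow C h"] iso h that by simp
  then show ?thesis using assms by metis
qed

end

lemma prod_cat_simps [simp]:
  "Obj (prod_cat C D) = Obj C \<times> Obj D"
  "Arr (prod_cat C D) = Arr C \<times> Arr D"
  "Dom (prod_cat C D) (f, g) = (Dom C f, Dom D g)"
  "Cod (prod_cat C D) (f, g) = (Cod C f, Cod D g)"
  "Idn (prod_cat C D) (X, Y) = (Idn C X, Idn D Y)"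
  "(f', g') \<cdot>\<^bsub>prod_cat C D\<^esub> (f, g) = (f' \<cdot>\<^bsub>C\<^esub> f, g' \<cdot>\<^bsub>D\<^esub> g)"
  by (simp_all add: prod_cat_def)

lemma category_prod_cat:
  assumes "category C" "category D"
  shows "category (prod_cat C D)"
proof -
  interpret C: category C by fact
  interpret D: category D by fact
  show ?thesis
    by unfold_locales
       (auto simp: Hom_iff C.Dom_Obj D.Dom_Obj C.Cod_Obj D.Cod_Obj)
qed

context is_functor
begin

lemma amap_simps [simp]:
  assumes "f \<in> Arr C"
  shows "amap F f \<in> Arr D" "Dom D (amap F f) = omap F (Dom C f)" "Cod D (amap F f) = omap F (Cod C f)"
  using amap_Hom[of f "Dom C f" "Cod C f"] assms by (simp_all add: Hom_iff)

lemma amap_Comp_Arr: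
  assumes "f \<in> Arr C" "g \<in> Arr C" "Dom C g = Cod C f"
  shows "amap F (g \<cdot>\<^bsub>C\<^esub> f) = amap F g \<cdot>\<^bsub>D\<^esub> amap F f"
  using amap_Comp[of f "Dom C f" "Cod C f" g "Cod C g"] assms by (simp add: Hom_iff)

end

lemma bifunctor_interchange:
  assumes "is_functor (prod_cat C D) E F"
    and "f \<in> Arr C" "f' \<in> Arr C" "Dom C f' = Cod C f"
    and "g \<in> Arr D" "g' \<in> Arr D" "Dom D g' = Cod D g"
  shows "(f' \<boxtimes>\<^bsub>F\<^esub> g') \<cdot>\<^bsub>E\<^esub> (f \<boxtimes>\<^bsub>F\<^esub> g) = (f' \<cdot>\<^bsub>C\<^esub> f) \<boxtimes>\<^bsub>F\<^esub> (g' \<cdot>\<^bsub>D\<^esub> g)"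
  using is_functor.amap_Comp_Arr[OF assms(1), of "(f, g)" "(f', g')"] assms by simp

lemma bifunctor_Idn:
  assumes "is_functor (prod_cat C D) E F" "X \<in> Obj C" "Y \<in> Obj D"
  shows "Idn C X \<boxtimes>\<^bsub>F\<^esub> Idn D Y = Idn E (X \<otimes>\<^bsub>F\<^esub> Y)"
  using is_functor.amap_Idn[OF assms(1), of "(X, Y)"] assms by simp

section \<open>Transposition along an adjunction\<close>

context adjunction
begin

lemma unit_simps:
  assumes "X \<in> Obj C"
  shows "\<eta> X \<in> Arr C" "Dom C (\<eta> X) = X" "Cod C (\<eta> X) = omap R (omap L X)"
  using unit.component[OF assms] by (simp_all add: Hom_iff id_functor_def comp_functor_def)

lemma counit_simps:
  assumes "Y \<in> Obj D"
  shows "\<epsilon> Y \<in> Arr D" "Dom D (\<epsilon> Y) = omap L (omap R Y)" "Cod D (\<epsilon> Y) = Y"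
  using counit.component[OF assms] by (simp_all add: Hom_iff id_functor_def comp_functor_def)

lemma unit_natural_Arr:
  assumes "f \<in> Arr C"
  shows "\<eta> (Cod C f) \<cdot>\<^bsub>C\<^esub> f = amap R (amap L f) \<cdot>\<^bsub>C\<^esub> \<eta> (Dom C f)"
  using unit.natural[of f "Dom C f" "Cod C f"] assms
  by (simp add: Hom_iff id_functor_def comp_functor_def)

lemma counit_natural_Arr:
  assumes "f \<in> Arr D"
  shows "\<epsilon> (Cod D f) \<cdot>\<^bsub>D\<^esub> amap L (amap R f) = f \<cdot>\<^bsub>D\<^esub> \<epsilon> (Dom D f)"
  using counit.natural[of f "Dom D f" "Cod D f"] assms
  by (simp add: Hom_iff id_functor_def comp_functor_def)

lemma transpose_simps:
  assumes "f \<in> Arr C" "Y \<in> Obj D" "Cod C f = omap R Y"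
  shows "transpose D L \<epsilon> Y f \<in> Arr D" "Dom D (transpose D L \<epsilon> Y f) = omap L (Dom C f)"
    "Cod D (transpose D L \<epsilon> Y f) = Y"
  using assms by (simp_all add: transpose_def counit_simps)

lemma transpose_unit:
  assumes f: "f \<in> Arr C" and Y: "Y \<in> Obj D" and cod: "Cod C f = omap R Y"
  shows "amap R (transpose D L \<epsilon> Y f) \<cdot>\<^bsub>C\<^esub> \<eta> (Dom C f) = f"
proof -
  have X: "Dom C f \<in> Obj C" using f by (rule unit.F.src.Dom_Obj)
  have RY: "omap R Y \<in> Obj C" using Y by (rule R.omap_Obj)
  have "amap R (transpose D L \<epsilon> Y f) \<cdot>\<^bsub>C\<^esub> \<eta> (Dom C f)
      = amap R (\<epsilon> Y) \<cdot>\<^bsub>C\<^esub> amap R (amap L f) \<cdot>\<^bsub>C\<^esub> \<eta> (Dom C f)"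
    using assms X by (simp add: transpose_def R.amap_Comp_Arr unit_simps counit_simps)
  also have "\<dots> = amap R (\<epsilon> Y) \<cdot>\<^bsub>C\<^esub> \<eta> (omap R Y) \<cdot>\<^bsub>C\<^esub> f"
    using unit_natural_Arr[OF f] cod by simp
  also have "\<dots> = Idn C (omap R Y) \<cdot>\<^bsub>C\<^esub> f"
    by (rule unit.F.src.Comp_eq_extend[OF triangle_R[OF Y]])
       (use assms RY in \<open>simp_all add: unit_simps counit_simps\<close>)
  also have "\<dots> = f" using f cod by simp
  finally show ?thesis .
qed

text \<open>
  An arrow \<open>k : L X \<rightarrow> Z\<close> is recovered from \<open>R k \<cdot> \<eta> X\<close> as its transpose, by naturality of the counit
  and the triangle identity for \<open>L\<close>.
\<close>

lemma unit_detects_equality: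
  assumes X: "X \<in> Obj C"
    and p: "p \<in> Arr D" "Dom D p = omap L X" and q: "q \<in> Arr D" "Dom D q = omap L X"
    and cod: "Cod D p = Cod D q"
    and eq: "amap R p \<cdot>\<^bsub>C\<^esub> \<eta> X = amap R q \<cdot>\<^bsub>C\<^esub> \<eta> X"
  shows "p = q"
proof -
  have recover: "k = \<epsilon> (Cod D k) \<cdot>\<^bsub>D\<^esub> amap L (amap R k \<cdot>\<^bsub>C\<^esub> \<eta> X)"
    if k: "k \<in> Arr D" and dom: "Dom D k = omap L X" for k
  proof -
    have LX: "omap L X \<in> Obj D" using X by (rule L.omap_Obj)
    have Z: "Cod D k \<in> Obj D" using k by (rule counit.F.src.Cod_Obj)
    have "k = k \<cdot>\<^bsub>D\<^esub> \<epsilon> (omap L X) \<cdot>\<^bsub>D\<^esub> amap L (\<eta> X)"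
      using k dom triangle_L[OF X] by simp
    also have "\<dots> = (k \<cdot>\<^bsub>D\<^esub> \<epsilon> (omap L X)) \<cdot>\<^bsub>D\<^esub> amap L (\<eta> X)"
      using k dom X LX by (simp add: unit_simps counit_simps)
    also have "\<dots> = (\<epsilon> (Cod D k) \<cdot>\<^bsub>D\<^esub> amap L (amap R k)) \<cdot>\<^bsub>D\<^esub> amap L (\<eta> X)"
      using counit_natural_Arr[OF k] dom by simp
    also have "\<dots> = \<epsilon> (Cod D k) \<cdot>\<^bsub>D\<^esub> amap L (amap R k \<cdot>\<^bsub>C\<^esub> \<eta> X)"
      using k dom X Z by (simp add: unit_simps counit_simps L.amap_Comp_Arr)
    finally show ?thesis .
  qed
  have "p = \<epsilon> (Cod D p) \<cdot>\<^bsub>D\<^esub> amap L (amap R p \<cdot>\<^bsub>C\<^esub> \<eta> X)" using p by (rule recover)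
  also have "\<dots> = \<epsilon> (Cod D q) \<cdot>\<^bsub>D\<^esub> amap L (amap R q \<cdot>\<^bsub>C\<^esub> \<eta> X)" by (simp only: cod eq)
  also have "\<dots> = q" using recover[OF q] by (rule sym)
  finally show ?thesis .
qed

end

section \<open>Actions whose orbit functor has a left adjoint\<close>

locale action_with_orbit_adjoint =
  strong_left_action V T I a l r A S m u + adj: adjunction A V L "act_on A S J" \<eta> \<epsilon>
  for V :: "('v, 'n) cat" and T :: "('v \<times> 'v, 'n \<times> 'n, 'v, 'n) fctr" and I :: 'v
    and a :: "'v \<Rightarrow> 'v \<Rightarrow> 'v \<Rightarrow> 'n" and l r :: "'v \<Rightarrow> 'n"
    and A :: "('o, 'm) cat" and S :: "('v \<times> 'o, 'n \<times> 'm, 'o, 'm) fctr"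
    and m :: "'v \<Rightarrow> 'v \<Rightarrow> 'o \<Rightarrow> 'm" and u :: "'o \<Rightarrow> 'm"
    and J :: 'o and L :: "('o, 'm, 'v, 'n) fctr" and \<eta> :: "'o \<Rightarrow> 'm" and \<epsilon> :: "'v \<Rightarrow> 'n" +
  assumes J_Obj [simp]: "J \<in> Obj A"
begin

abbreviation comp_A (infixr "\<cdot>\<^sub>A" 65) where "g \<cdot>\<^sub>A f \<equiv> g \<cdot>\<^bsub>A\<^esub> f"
abbreviation comp_V (infixr "\<cdot>\<^sub>V" 65) where "q \<cdot>\<^sub>V p \<equiv> q \<cdot>\<^bsub>V\<^esub> p"
abbreviation tensor_obj (infixr "\<otimes>\<^sub>T" 75) where "X \<otimes>\<^sub>T Y \<equiv> X \<otimes>\<^bsub>T\<^esub> Y"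
abbreviation tensor_arr (infixr "\<boxtimes>\<^sub>T" 75) where "p \<boxtimes>\<^sub>T q \<equiv> p \<boxtimes>\<^bsub>T\<^esub> q"
abbreviation act_obj (infixr "\<otimes>\<^sub>S" 75) where "X \<otimes>\<^sub>S B \<equiv> X \<otimes>\<^bsub>S\<^esub> B"
abbreviation act_arr (infixr "\<boxtimes>\<^sub>S" 75) where "p \<boxtimes>\<^sub>S f \<equiv> p \<boxtimes>\<^bsub>S\<^esub> f"
abbreviation "L\<^sub>0 \<equiv> omap L"
abbreviation "L\<^sub>1 \<equiv> amap L"
abbreviation "id\<^sub>V \<equiv> Idn V"
abbreviation "id\<^sub>A \<equiv> Idn A"
abbreviation "\<gamma>\<^sub>0 \<equiv> ind_assoc_tilde V T A S m J L \<eta> \<epsilon>"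
abbreviation "\<gamma> \<equiv> ind_assoc V T A S m J L \<eta> \<epsilon>"
abbreviation "lu \<equiv> ind_lunit I A S u J L \<epsilon>"

lemma orbit_simps [simp]:
  "omap (act_on A S J) X = X \<otimes>\<^sub>S J" "amap (act_on A S J) p = p \<boxtimes>\<^sub>S id\<^sub>A J"
  by (simp_all add: act_on_def)

declare unit_Obj [simp]

lemma Obj_simps [simp]:
  "B \<in> Obj A \<Longrightarrow> L\<^sub>0 B \<in> Obj V"
  "X \<in> Obj V \<Longrightarrow> Y \<in> Obj V \<Longrightarrow> X \<otimes>\<^sub>T Y \<in> Obj V"
  "X \<in> Obj V \<Longrightarrow> B \<in> Obj A \<Longrightarrow> X \<otimes>\<^sub>S B \<in> Obj A"
  using adj.L.omap_Obj tensor.omap_Obj[of "(X, Y)"] act.omap_Obj[of "(X, B)"] by simp_all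

lemma Dom_Cod_Obj [simp]:
  "f \<in> Arr A \<Longrightarrow> Dom A f \<in> Obj A" "f \<in> Arr A \<Longrightarrow> Cod A f \<in> Obj A"
  "p \<in> Arr V \<Longrightarrow> Dom V p \<in> Obj V" "p \<in> Arr V \<Longrightarrow> Cod V p \<in> Obj V"
  by (simp_all add: Dom_Obj Cod_Obj act.Dom_Obj act.Cod_Obj)

lemma mult_simps [simp]:
  assumes "X \<in> Obj V" "Y \<in> Obj V" "B \<in> Obj A"
  shows "m X Y B \<in> Arr A" "Dom A (m X Y B) = (X \<otimes>\<^sub>T Y) \<otimes>\<^sub>S B" "Cod A (m X Y B) = X \<otimes>\<^sub>S Y \<otimes>\<^sub>S B"
    "iso_arrow A (m X Y B)"
  using mult_Hom[OF assms] mult_iso[OF assms] by (simp_all add: Hom_iff)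

lemma unitor_simps [simp]:
  assumes "B \<in> Obj A"
  shows "u B \<in> Arr A" "Dom A (u B) = I \<otimes>\<^sub>S B" "Cod A (u B) = B" "iso_arrow A (u B)"
  using unit_Hom[OF assms] unit_iso[OF assms] by (simp_all add: Hom_iff)

lemma V_unitor_simps [simp]:
  assumes "X \<in> Obj V"
  shows "l X \<in> Arr V" "Dom V (l X) = I \<otimes>\<^sub>T X" "Cod V (l X) = X"
    "r X \<in> Arr V" "Dom V (r X) = X" "Cod V (r X) = X \<otimes>\<^sub>T I"
  using lunit_Hom[OF assms] runit_Hom[OF assms] by (simp_all add: Hom_iff)

lemma V_assoc_simps [simp]:
  assumes "X \<in> Obj V" "Y \<in> Obj V" "Z \<in> Obj V"
  shows "a X Y Z \<in> Arr V" "Dom V (a X Y Z) = (X \<otimes>\<^sub>T Y) \<otimes>\<^sub>T Z"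
    "Cod V (a X Y Z) = X \<otimes>\<^sub>T Y \<otimes>\<^sub>T Z"
  using assoc_Hom[OF assms] by (simp_all add: Hom_iff)

lemma eta_simps [simp]:
  assumes "B \<in> Obj A"
  shows "\<eta> B \<in> Arr A" "Dom A (\<eta> B) = B" "Cod A (\<eta> B) = L\<^sub>0 B \<otimes>\<^sub>S J"
  using adj.unit_simps[OF assms] by simp_all

lemma epsilon_simps [simp]:
  assumes "X \<in> Obj V"
  shows "\<epsilon> X \<in> Arr V" "Dom V (\<epsilon> X) = L\<^sub>0 (X \<otimes>\<^sub>S J)" "Cod V (\<epsilon> X) = X"
  using adj.counit_simps[OF assms] by simp_all

lemmas act_interchange = bifunctor_interchange[OF act.is_functor_axioms]
lemmas act_Idn = bifunctor_Idn[OF act.is_functor_axioms]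

lemma act_iso:
  assumes X: "X \<in> Obj V" and f: "iso_arrow A f"
  shows "iso_arrow A (id\<^sub>V X \<boxtimes>\<^sub>S f)"
proof -
  have "f \<in> Arr A" using f by (simp add: iso_arrow_def inverse_arrows_def)
  then have "inverse_arrows A (id\<^sub>V X \<boxtimes>\<^sub>S f) (id\<^sub>V X \<boxtimes>\<^sub>S inv_arrow A f)"
    using X f by (simp add: inverse_arrows_def Hom_iff act_interchange act_Idn)
  then show ?thesis unfolding iso_arrow_def by blast
qed

lemma mult_natural_Arr:
  assumes "f \<in> Arr V" "g \<in> Arr V" "h \<in> Arr A"
  shows "m (Cod V f) (Cod V g) (Cod A h) \<cdot>\<^sub>A ((f \<boxtimes>\<^sub>T g) \<boxtimes>\<^sub>S h) = (f \<boxtimes>\<^sub>S (g \<boxtimes>\<^sub>S h)) \<cdot>\<^sub>A m (Dom V f) (Dom V g) (Dom A h)"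
  using mult_natural[of f "Dom V f" "Cod V f" g "Dom V g" "Cod V g" h "Dom A h" "Cod A h"] assms
  by (simp add: Hom_iff)

lemma act_interchange_extend:
  assumes "f \<in> Arr V" "f' \<in> Arr V" "Dom V f' = Cod V f"
    and "g \<in> Arr A" "g' \<in> Arr A" "Dom A g' = Cod A g"
    and "t \<in> Arr A" "Cod A t = Dom V f \<otimes>\<^sub>S Dom A g"
  shows "(f' \<boxtimes>\<^sub>S g') \<cdot>\<^sub>A (f \<boxtimes>\<^sub>S g) \<cdot>\<^sub>A t = ((f' \<cdot>\<^sub>V f) \<boxtimes>\<^sub>S (g' \<cdot>\<^sub>A g)) \<cdot>\<^sub>A t"
  by (rule act.Comp_eq_extend[OF act_interchange]) (use assms in simp_all)

lemma mult_natural_extend: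
  assumes "f \<in> Arr V" "g \<in> Arr V" "h \<in> Arr A" "t \<in> Arr A"
   "Cod A t = (Dom V f \<otimes>\<^sub>T Dom V g) \<otimes>\<^sub>S Dom A h"
  shows "m (Cod V f) (Cod V g) (Cod A h) \<cdot>\<^sub>A ((f \<boxtimes>\<^sub>T g) \<boxtimes>\<^sub>S h) \<cdot>\<^sub>A t
       = (f \<boxtimes>\<^sub>S (g \<boxtimes>\<^sub>S h)) \<cdot>\<^sub>A m (Dom V f) (Dom V g) (Dom A h) \<cdot>\<^sub>A t"
  using act.Comp_eq_extend[OF mult_natural_Arr, of f g h t] assms by simp

lemma orbit_detects:
  assumes "B \<in> Obj A"
    and "p \<in> Arr V" "Dom V p = L\<^sub>0 B" and "q \<in> Arr V" "Dom V q = L\<^sub>0 B" "Cod V p = Cod V q"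
    and "(p \<boxtimes>\<^sub>S id\<^sub>A J) \<cdot>\<^sub>A \<eta> B = (q \<boxtimes>\<^sub>S id\<^sub>A J) \<cdot>\<^sub>A \<eta> B"
  shows "p = q"
  using adj.unit_detects_equality[of B p q] assms by simp

lemma ind_assoc_tilde_simps [simp]:
  assumes "B \<in> Obj A" "C \<in> Obj A"
  shows "\<gamma>\<^sub>0 B C \<in> Arr V" "Dom V (\<gamma>\<^sub>0 B C) = L\<^sub>0 (L\<^sub>0 B \<otimes>\<^sub>S C)" "Cod V (\<gamma>\<^sub>0 B C) = L\<^sub>0 B \<otimes>\<^sub>T L\<^sub>0 C"
  using assms by (simp_all add: ind_assoc_tilde_def adj.transpose_simps)

text \<open>
  The defining property of \<open>\<gamma>\<^sub>0\<close> as a transpose, with \<open>m\<close> moved to the left so that no inverse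
  occurs. All later computations with \<open>\<gamma>\<^sub>0\<close> go through it; it is also the right unit law of the
  induced structure.
\<close>

lemma ind_assoc_tilde_eta:
  assumes B: "B \<in> Obj A" and C: "C \<in> Obj A"
  shows "m (L\<^sub>0 B) (L\<^sub>0 C) J \<cdot>\<^sub>A (\<gamma>\<^sub>0 B C \<boxtimes>\<^sub>S id\<^sub>A J) \<cdot>\<^sub>A \<eta> (L\<^sub>0 B \<otimes>\<^sub>S C) = id\<^sub>V (L\<^sub>0 B) \<boxtimes>\<^sub>S \<eta> C"
proof -
  let ?m = "m (L\<^sub>0 B) (L\<^sub>0 C) J"
  let ?f = "inv_arrow A ?m \<cdot>\<^sub>A (id\<^sub>V (L\<^sub>0 B) \<boxtimes>\<^sub>S \<eta> C)"
  have "(\<gamma>\<^sub>0 B C \<boxtimes>\<^sub>S id\<^sub>A J) \<cdot>\<^sub>A \<eta> (L\<^sub>0 B \<otimes>\<^sub>S C) = ?f"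
    using adj.transpose_unit[of ?f "L\<^sub>0 B \<otimes>\<^sub>T L\<^sub>0 C"] B C by (simp add: ind_assoc_tilde_def)
  moreover have "?m \<cdot>\<^sub>A inv_arrow A ?m \<cdot>\<^sub>A (id\<^sub>V (L\<^sub>0 B) \<boxtimes>\<^sub>S \<eta> C) = id\<^sub>V (L\<^sub>0 B) \<boxtimes>\<^sub>S \<eta> C"
    using act.Comp_eq_extend[of ?m "inv_arrow A ?m" _ "id\<^sub>V (L\<^sub>0 B) \<boxtimes>\<^sub>S \<eta> C"] B C by simp
  ultimately show ?thesis by simp
qed

text \<open>
  The transpose of \<open>(u J)\<^sup>-\<^sup>1 : J \<rightarrow> I * J\<close>, which is the counit of the opmonoidal structure of \<open>L\<close>. By
  functoriality of the action the induced left unitor is \<open>u \<cdot> (\<epsilon>\<^sub>0 * -)\<close>.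
\<close>

definition \<epsilon>\<^sub>0 where "\<epsilon>\<^sub>0 = \<epsilon> I \<cdot>\<^sub>V L\<^sub>1 (inv_arrow A (u J))"

lemma counit0_simps [simp]: "\<epsilon>\<^sub>0 \<in> Arr V" "Dom V \<epsilon>\<^sub>0 = L\<^sub>0 J" "Cod V \<epsilon>\<^sub>0 = I"
  by (simp_all add: \<epsilon>\<^sub>0_def)

lemma counit0_eta: "u J \<cdot>\<^sub>A (\<epsilon>\<^sub>0 \<boxtimes>\<^sub>S id\<^sub>A J) \<cdot>\<^sub>A \<eta> J = id\<^sub>A J"
  using adj.transpose_unit[of "inv_arrow A (u J)" I] by (simp add: \<epsilon>\<^sub>0_def transpose_def)

lemma ind_lunit_eq: "B \<in> Obj A \<Longrightarrow> lu B = u B \<cdot>\<^sub>A (\<epsilon>\<^sub>0 \<boxtimes>\<^sub>S id\<^sub>A B)"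
  by (simp add: ind_lunit_def \<epsilon>\<^sub>0_def act_interchange)

lemma ind_assoc_simps [simp]:
  assumes "B \<in> Obj A" "C \<in> Obj A" "D \<in> Obj A"
  shows "\<gamma> B C D \<in> Arr A" "Dom A (\<gamma> B C D) = L\<^sub>0 (L\<^sub>0 B \<otimes>\<^sub>S C) \<otimes>\<^sub>S D"
    "Cod A (\<gamma> B C D) = L\<^sub>0 B \<otimes>\<^sub>S L\<^sub>0 C \<otimes>\<^sub>S D"
  using assms by (simp_all add: ind_assoc_def)

lemma ind_lunit_simps [simp]:
  assumes "B \<in> Obj A"
  shows "lu B \<in> Arr A" "Dom A (lu B) = L\<^sub>0 J \<otimes>\<^sub>S B" "Cod A (lu B) = B"
  using assms by (simp_all add: ind_lunit_eq)

lemma unitor_natural_Arr: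
  assumes "f \<in> Arr A"
  shows "u (Cod A f) \<cdot>\<^sub>A (id\<^sub>V I \<boxtimes>\<^sub>S f) = f \<cdot>\<^sub>A u (Dom A f)"
  using unit_natural[of f "Dom A f" "Cod A f"] assms by (simp add: Hom_iff)

lemma eta_natural:
  assumes "f \<in> Arr A"
  shows "(L\<^sub>1 f \<boxtimes>\<^sub>S id\<^sub>A J) \<cdot>\<^sub>A \<eta> (Dom A f) = \<eta> (Cod A f) \<cdot>\<^sub>A f"
  using adj.unit_natural_Arr[OF assms] by simp

section \<open>The left adjoint is opmonoidal\<close>

text \<open>
  The transposes agree because \<open>\<eta>\<close> and \<open>m\<close> are natural: both reduce to
  \<open>L f * (\<eta> \<cdot> h)\<close> when composed with the invertible \<open>m\<close>.
\<close>

lemma ind_assoc_tilde_natural: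
  assumes f: "f \<in> Arr A" and h: "h \<in> Arr A"
  shows "\<gamma>\<^sub>0 (Cod A f) (Cod A h) \<cdot>\<^sub>V L\<^sub>1 (L\<^sub>1 f \<boxtimes>\<^sub>S h) = (L\<^sub>1 f \<boxtimes>\<^sub>T L\<^sub>1 h) \<cdot>\<^sub>V \<gamma>\<^sub>0 (Dom A f) (Dom A h)"
proof -
  define B B' C C' where d: "B = Dom A f" "B' = Cod A f" "C = Dom A h" "C' = Cod A h"
  have [simp]: "B \<in> Obj A" "B' \<in> Obj A" "C \<in> Obj A" "C' \<in> Obj A" unfolding d using f h by simp_all
  have [simp]: "Dom A f = B" "Cod A f = B'" "Dom A h = C" "Cod A h = C'" by (simp_all add: d)
  have "m (L\<^sub>0 B') (L\<^sub>0 C') J \<cdot>\<^sub>A ((\<gamma>\<^sub>0 B' C' \<cdot>\<^sub>V L\<^sub>1 (L\<^sub>1 f \<boxtimes>\<^sub>S h)) \<boxtimes>\<^sub>S id\<^sub>A J) \<cdot>\<^sub>A \<eta> (L\<^sub>0 B \<otimes>\<^sub>S C)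
     = m (L\<^sub>0 B') (L\<^sub>0 C') J \<cdot>\<^sub>A (\<gamma>\<^sub>0 B' C' \<boxtimes>\<^sub>S id\<^sub>A J) \<cdot>\<^sub>A (L\<^sub>1 (L\<^sub>1 f \<boxtimes>\<^sub>S h) \<boxtimes>\<^sub>S id\<^sub>A J) \<cdot>\<^sub>A \<eta> (L\<^sub>0 B \<otimes>\<^sub>S C)"
    using f h by (simp add: act_interchange_extend)
  also have "\<dots> = (m (L\<^sub>0 B') (L\<^sub>0 C') J \<cdot>\<^sub>A (\<gamma>\<^sub>0 B' C' \<boxtimes>\<^sub>S id\<^sub>A J) \<cdot>\<^sub>A \<eta> (L\<^sub>0 B' \<otimes>\<^sub>S C')) \<cdot>\<^sub>A (L\<^sub>1 f \<boxtimes>\<^sub>S h)"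
    using eta_natural[of "L\<^sub>1 f \<boxtimes>\<^sub>S h"] f h by simp
  also have "\<dots> = (L\<^sub>1 f \<boxtimes>\<^sub>S (L\<^sub>1 h \<boxtimes>\<^sub>S id\<^sub>A J)) \<cdot>\<^sub>A (id\<^sub>V (L\<^sub>0 B) \<boxtimes>\<^sub>S \<eta> C)"
    using f h eta_natural[OF h] by (simp add: ind_assoc_tilde_eta act_interchange)
  also have "\<dots> = (L\<^sub>1 f \<boxtimes>\<^sub>S (L\<^sub>1 h \<boxtimes>\<^sub>S id\<^sub>A J)) \<cdot>\<^sub>A m (L\<^sub>0 B) (L\<^sub>0 C) J \<cdot>\<^sub>A (\<gamma>\<^sub>0 B C \<boxtimes>\<^sub>S id\<^sub>A J) \<cdot>\<^sub>A \<eta> (L\<^sub>0 B \<otimes>\<^sub>S C)"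
    by (simp add: ind_assoc_tilde_eta)
  also have "\<dots> = m (L\<^sub>0 B') (L\<^sub>0 C') J \<cdot>\<^sub>A ((L\<^sub>1 f \<boxtimes>\<^sub>T L\<^sub>1 h) \<boxtimes>\<^sub>S id\<^sub>A J) \<cdot>\<^sub>A (\<gamma>\<^sub>0 B C \<boxtimes>\<^sub>S id\<^sub>A J) \<cdot>\<^sub>A \<eta> (L\<^sub>0 B \<otimes>\<^sub>S C)"
    using f h mult_natural_extend[of "L\<^sub>1 f" "L\<^sub>1 h" "id\<^sub>A J" "(\<gamma>\<^sub>0 B C \<boxtimes>\<^sub>S id\<^sub>A J) \<cdot>\<^sub>A \<eta> (L\<^sub>0 B \<otimes>\<^sub>S C)"] by simp
  also have "\<dots> = m (L\<^sub>0 B') (L\<^sub>0 C') J \<cdot>\<^sub>A (((L\<^sub>1 f \<boxtimes>\<^sub>T L\<^sub>1 h) \<cdot>\<^sub>V \<gamma>\<^sub>0 B C) \<boxtimes>\<^sub>S id\<^sub>A J) \<cdot>\<^sub>A \<eta> (L\<^sub>0 B \<otimes>\<^sub>S C)"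
    using f h by (simp add: act_interchange_extend)
  finally have *: "((\<gamma>\<^sub>0 B' C' \<cdot>\<^sub>V L\<^sub>1 (L\<^sub>1 f \<boxtimes>\<^sub>S h)) \<boxtimes>\<^sub>S id\<^sub>A J) \<cdot>\<^sub>A \<eta> (L\<^sub>0 B \<otimes>\<^sub>S C)
      = (((L\<^sub>1 f \<boxtimes>\<^sub>T L\<^sub>1 h) \<cdot>\<^sub>V \<gamma>\<^sub>0 B C) \<boxtimes>\<^sub>S id\<^sub>A J) \<cdot>\<^sub>A \<eta> (L\<^sub>0 B \<otimes>\<^sub>S C)"
    by (rule act.iso_cancel_left[rotated]) (use f h in simp_all)
  show ?thesis
    by (rule orbit_detects[of "L\<^sub>0 B \<otimes>\<^sub>S C"]) (use f h * in simp_all)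
qed

lemma ind_assoc_natural:
  assumes f: "f \<in> Arr A" and g: "g \<in> Arr A" and h: "h \<in> Arr A"
  shows "\<gamma> (Cod A f) (Cod A g) (Cod A h) \<cdot>\<^sub>A (L\<^sub>1 (L\<^sub>1 f \<boxtimes>\<^sub>S g) \<boxtimes>\<^sub>S h)
       = (L\<^sub>1 f \<boxtimes>\<^sub>S (L\<^sub>1 g \<boxtimes>\<^sub>S h)) \<cdot>\<^sub>A \<gamma> (Dom A f) (Dom A g) (Dom A h)"
proof -
  let ?m = "m (L\<^sub>0 (Cod A f)) (L\<^sub>0 (Cod A g)) (Cod A h)"
  have "\<gamma> (Cod A f) (Cod A g) (Cod A h) \<cdot>\<^sub>A (L\<^sub>1 (L\<^sub>1 f \<boxtimes>\<^sub>S g) \<boxtimes>\<^sub>S h)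
      = ?m \<cdot>\<^sub>A ((\<gamma>\<^sub>0 (Cod A f) (Cod A g) \<cdot>\<^sub>V L\<^sub>1 (L\<^sub>1 f \<boxtimes>\<^sub>S g)) \<boxtimes>\<^sub>S h)"
    using f g h by (simp add: ind_assoc_def act_interchange)
  also have "\<dots> = ?m \<cdot>\<^sub>A ((L\<^sub>1 f \<boxtimes>\<^sub>T L\<^sub>1 g) \<boxtimes>\<^sub>S h) \<cdot>\<^sub>A (\<gamma>\<^sub>0 (Dom A f) (Dom A g) \<boxtimes>\<^sub>S id\<^sub>A (Dom A h))"
    using f g h by (simp add: ind_assoc_tilde_natural act_interchange)
  also have "\<dots> = (L\<^sub>1 f \<boxtimes>\<^sub>S (L\<^sub>1 g \<boxtimes>\<^sub>S h)) \<cdot>\<^sub>A \<gamma> (Dom A f) (Dom A g) (Dom A h)"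
    using f g h mult_natural_extend[of "L\<^sub>1 f" "L\<^sub>1 g" h "\<gamma>\<^sub>0 (Dom A f) (Dom A g) \<boxtimes>\<^sub>S id\<^sub>A (Dom A h)"]
    by (simp add: ind_assoc_def)
  finally show ?thesis .
qed

lemma ind_lunit_natural:
  assumes f: "f \<in> Arr A"
  shows "lu (Cod A f) \<cdot>\<^sub>A (L\<^sub>1 (id\<^sub>A J) \<boxtimes>\<^sub>S f) = f \<cdot>\<^sub>A lu (Dom A f)"
proof -
  have "lu (Cod A f) \<cdot>\<^sub>A (L\<^sub>1 (id\<^sub>A J) \<boxtimes>\<^sub>S f) = u (Cod A f) \<cdot>\<^sub>A (id\<^sub>V I \<boxtimes>\<^sub>S f) \<cdot>\<^sub>A (\<epsilon>\<^sub>0 \<boxtimes>\<^sub>S id\<^sub>A (Dom A f))"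
    using f by (simp add: ind_lunit_eq adj.L.amap_Idn act_interchange)
  also have "\<dots> = f \<cdot>\<^sub>A lu (Dom A f)"
    using f act.Comp_eq_extend[OF unitor_natural_Arr[OF f], of "\<epsilon>\<^sub>0 \<boxtimes>\<^sub>S id\<^sub>A (Dom A f)"]
    by (simp add: ind_lunit_eq)
  finally show ?thesis .
qed

text \<open>
  After transposition the left unit axiom of the action turns \<open>l\<close> into \<open>u \<cdot> m\<close>. Then \<open>\<gamma>\<^sub>0\<close> disappears
  and what is left is naturality of \<open>\<lambda>\<close> at \<open>\<eta> B\<close>.
\<close>

lemma opmonoidal_lunit:
  assumes B: "B \<in> Obj A"
  shows "l (L\<^sub>0 B) \<cdot>\<^sub>V (\<epsilon>\<^sub>0 \<boxtimes>\<^sub>T id\<^sub>V (L\<^sub>0 B)) \<cdot>\<^sub>V \<gamma>\<^sub>0 J B = L\<^sub>1 (lu B)"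
proof (rule orbit_detects[of "L\<^sub>0 J \<otimes>\<^sub>S B"])
  let ?x = "L\<^sub>0 B" and ?P = "L\<^sub>0 J \<otimes>\<^sub>S B"
  have "((l ?x \<cdot>\<^sub>V (\<epsilon>\<^sub>0 \<boxtimes>\<^sub>T id\<^sub>V ?x) \<cdot>\<^sub>V \<gamma>\<^sub>0 J B) \<boxtimes>\<^sub>S id\<^sub>A J) \<cdot>\<^sub>A \<eta> ?P
      = (l ?x \<boxtimes>\<^sub>S id\<^sub>A J) \<cdot>\<^sub>A ((\<epsilon>\<^sub>0 \<boxtimes>\<^sub>T id\<^sub>V ?x) \<boxtimes>\<^sub>S id\<^sub>A J) \<cdot>\<^sub>A (\<gamma>\<^sub>0 J B \<boxtimes>\<^sub>S id\<^sub>A J) \<cdot>\<^sub>A \<eta> ?P"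
    using B by (simp add: act_interchange_extend)
  also have "\<dots> = u (?x \<otimes>\<^sub>S J) \<cdot>\<^sub>A m I ?x J \<cdot>\<^sub>A ((\<epsilon>\<^sub>0 \<boxtimes>\<^sub>T id\<^sub>V ?x) \<boxtimes>\<^sub>S id\<^sub>A J) \<cdot>\<^sub>A (\<gamma>\<^sub>0 J B \<boxtimes>\<^sub>S id\<^sub>A J) \<cdot>\<^sub>A \<eta> ?P"
    using B by (simp flip: act_lunit)
  also have "\<dots> = u (?x \<otimes>\<^sub>S J) \<cdot>\<^sub>A (\<epsilon>\<^sub>0 \<boxtimes>\<^sub>S id\<^sub>A (?x \<otimes>\<^sub>S J)) \<cdot>\<^sub>A m (L\<^sub>0 J) ?x J \<cdot>\<^sub>A (\<gamma>\<^sub>0 J B \<boxtimes>\<^sub>S id\<^sub>A J) \<cdot>\<^sub>A \<eta> ?P"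
    using B mult_natural_extend[of \<epsilon>\<^sub>0 "id\<^sub>V ?x" "id\<^sub>A J" "(\<gamma>\<^sub>0 J B \<boxtimes>\<^sub>S id\<^sub>A J) \<cdot>\<^sub>A \<eta> ?P"] by (simp add: act_Idn)
  also have "\<dots> = lu (?x \<otimes>\<^sub>S J) \<cdot>\<^sub>A (L\<^sub>1 (id\<^sub>A J) \<boxtimes>\<^sub>S \<eta> B)"
    using B by (simp add: ind_assoc_tilde_eta ind_lunit_eq adj.L.amap_Idn)
  also have "\<dots> = \<eta> B \<cdot>\<^sub>A lu B"
    using B ind_lunit_natural[of "\<eta> B"] by simp
  also have "\<dots> = (L\<^sub>1 (lu B) \<boxtimes>\<^sub>S id\<^sub>A J) \<cdot>\<^sub>A \<eta> ?P"
    using B eta_natural[of "lu B"] by simp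
  finally show "((l ?x \<cdot>\<^sub>V (\<epsilon>\<^sub>0 \<boxtimes>\<^sub>T id\<^sub>V ?x) \<cdot>\<^sub>V \<gamma>\<^sub>0 J B) \<boxtimes>\<^sub>S id\<^sub>A J) \<cdot>\<^sub>A \<eta> ?P
      = (L\<^sub>1 (lu B) \<boxtimes>\<^sub>S id\<^sub>A J) \<cdot>\<^sub>A \<eta> ?P" .
qed (use B in simp_all)

text \<open>
  Both transposes become \<open>\<eta> B\<close> when composed with the invertible arrow \<open>(L B * u J) \<cdot> m\<close>: for
  \<open>r\<close> this is the triangle axiom of the action, and on the other side \<open>\<gamma>\<^sub>0\<close> and \<open>\<epsilon>\<^sub>0\<close> meet their units.
\<close>

lemma opmonoidal_runit:
  assumes B: "B \<in> Obj A"
  shows "(id\<^sub>V (L\<^sub>0 B) \<boxtimes>\<^sub>T \<epsilon>\<^sub>0) \<cdot>\<^sub>V \<gamma>\<^sub>0 B J \<cdot>\<^sub>V L\<^sub>1 (\<eta> B) = r (L\<^sub>0 B)" (is "?p = _")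
proof (rule orbit_detects[of B])
  let ?x = "L\<^sub>0 B"
  have "(id\<^sub>V ?x \<boxtimes>\<^sub>S u J) \<cdot>\<^sub>A m ?x I J \<cdot>\<^sub>A (?p \<boxtimes>\<^sub>S id\<^sub>A J) \<cdot>\<^sub>A \<eta> B
      = (id\<^sub>V ?x \<boxtimes>\<^sub>S u J) \<cdot>\<^sub>A m ?x I J \<cdot>\<^sub>A ((id\<^sub>V ?x \<boxtimes>\<^sub>T \<epsilon>\<^sub>0) \<boxtimes>\<^sub>S id\<^sub>A J)
          \<cdot>\<^sub>A (\<gamma>\<^sub>0 B J \<boxtimes>\<^sub>S id\<^sub>A J) \<cdot>\<^sub>A (L\<^sub>1 (\<eta> B) \<boxtimes>\<^sub>S id\<^sub>A J) \<cdot>\<^sub>A \<eta> B"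
    using B by (simp add: act_interchange_extend)
  also have "\<dots> = (id\<^sub>V ?x \<boxtimes>\<^sub>S u J) \<cdot>\<^sub>A (id\<^sub>V ?x \<boxtimes>\<^sub>S (\<epsilon>\<^sub>0 \<boxtimes>\<^sub>S id\<^sub>A J)) \<cdot>\<^sub>A m ?x (L\<^sub>0 J) J
          \<cdot>\<^sub>A (\<gamma>\<^sub>0 B J \<boxtimes>\<^sub>S id\<^sub>A J) \<cdot>\<^sub>A (L\<^sub>1 (\<eta> B) \<boxtimes>\<^sub>S id\<^sub>A J) \<cdot>\<^sub>A \<eta> B"
    using B mult_natural_extend[of "id\<^sub>V ?x" \<epsilon>\<^sub>0 "id\<^sub>A J"
        "(\<gamma>\<^sub>0 B J \<boxtimes>\<^sub>S id\<^sub>A J) \<cdot>\<^sub>A (L\<^sub>1 (\<eta> B) \<boxtimes>\<^sub>S id\<^sub>A J) \<cdot>\<^sub>A \<eta> B"] by simp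
  also have "\<dots> = (id\<^sub>V ?x \<boxtimes>\<^sub>S u J) \<cdot>\<^sub>A (id\<^sub>V ?x \<boxtimes>\<^sub>S (\<epsilon>\<^sub>0 \<boxtimes>\<^sub>S id\<^sub>A J)) \<cdot>\<^sub>A
        (m ?x (L\<^sub>0 J) J \<cdot>\<^sub>A (\<gamma>\<^sub>0 B J \<boxtimes>\<^sub>S id\<^sub>A J) \<cdot>\<^sub>A \<eta> (?x \<otimes>\<^sub>S J)) \<cdot>\<^sub>A \<eta> B"
    using B eta_natural[of "\<eta> B"] by simp
  also have "\<dots> = (id\<^sub>V ?x \<boxtimes>\<^sub>S (u J \<cdot>\<^sub>A (\<epsilon>\<^sub>0 \<boxtimes>\<^sub>S id\<^sub>A J) \<cdot>\<^sub>A \<eta> J)) \<cdot>\<^sub>A \<eta> B"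
    \<comment> \<open>The bracketed composite must be rewritten before reassociation dissolves it.\<close>
    using B by (simp only: ind_assoc_tilde_eta J_Obj) (simp add: act_interchange_extend)
  also have "\<dots> = \<eta> B"
    using B by (simp add: counit0_eta act_Idn)
  also have "\<dots> = ((id\<^sub>V ?x \<boxtimes>\<^sub>S u J) \<cdot>\<^sub>A m ?x I J \<cdot>\<^sub>A (r ?x \<boxtimes>\<^sub>S id\<^sub>A J)) \<cdot>\<^sub>A \<eta> B"
    using B by (simp only: act_triangle Obj_simps J_Obj) simp
  also have "\<dots> = (id\<^sub>V ?x \<boxtimes>\<^sub>S u J) \<cdot>\<^sub>A m ?x I J \<cdot>\<^sub>A (r ?x \<boxtimes>\<^sub>S id\<^sub>A J) \<cdot>\<^sub>A \<eta> B"
    using B by simp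
  finally have "m ?x I J \<cdot>\<^sub>A (?p \<boxtimes>\<^sub>S id\<^sub>A J) \<cdot>\<^sub>A \<eta> B = m ?x I J \<cdot>\<^sub>A (r ?x \<boxtimes>\<^sub>S id\<^sub>A J) \<cdot>\<^sub>A \<eta> B"
    by (rule act.iso_cancel_left[rotated]) (use B in \<open>simp_all add: act_iso\<close>)
  then show "(?p \<boxtimes>\<^sub>S id\<^sub>A J) \<cdot>\<^sub>A \<eta> B = (r ?x \<boxtimes>\<^sub>S id\<^sub>A J) \<cdot>\<^sub>A \<eta> B"
    by (rule act.iso_cancel_left[rotated]) (use B in simp_all)
qed (use B in simp_all)

text \<open>
  Composed with the invertible arrow \<open>(L B * m) \<cdot> m\<close>, both transposes become
  \<open>(L B * (L C * \<eta> D)) \<cdot> \<gamma> B C D\<close>. On the left-hand side \<open>\<gamma>\<^sub>0\<close> is eliminated twice; the right-hand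
  side is reached through naturality of \<open>\<gamma>\<close> at \<open>\<eta> D\<close> and the pentagon of the action.
\<close>

lemma opmonoidal_assoc:
  assumes [simp]: "B \<in> Obj A" "C \<in> Obj A" "D \<in> Obj A"
  shows "(id\<^sub>V (L\<^sub>0 B) \<boxtimes>\<^sub>T \<gamma>\<^sub>0 C D) \<cdot>\<^sub>V \<gamma>\<^sub>0 B (L\<^sub>0 C \<otimes>\<^sub>S D) \<cdot>\<^sub>V L\<^sub>1 (\<gamma> B C D)
       = a (L\<^sub>0 B) (L\<^sub>0 C) (L\<^sub>0 D) \<cdot>\<^sub>V (\<gamma>\<^sub>0 B C \<boxtimes>\<^sub>T id\<^sub>V (L\<^sub>0 D)) \<cdot>\<^sub>V \<gamma>\<^sub>0 (L\<^sub>0 B \<otimes>\<^sub>S C) D"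
    (is "?p = ?q")
proof (rule orbit_detects[of "L\<^sub>0 (L\<^sub>0 B \<otimes>\<^sub>S C) \<otimes>\<^sub>S D"])
  let ?x = "L\<^sub>0 B" and ?y = "L\<^sub>0 C" and ?z = "L\<^sub>0 D"
  let ?P = "?x \<otimes>\<^sub>S C" and ?Q = "?y \<otimes>\<^sub>S D"
  let ?R = "L\<^sub>0 ?P \<otimes>\<^sub>S D"
  have "(id\<^sub>V ?x \<boxtimes>\<^sub>S m ?y ?z J) \<cdot>\<^sub>A m ?x (?y \<otimes>\<^sub>T ?z) J \<cdot>\<^sub>A (?p \<boxtimes>\<^sub>S id\<^sub>A J) \<cdot>\<^sub>A \<eta> ?R
      = (id\<^sub>V ?x \<boxtimes>\<^sub>S m ?y ?z J) \<cdot>\<^sub>A m ?x (?y \<otimes>\<^sub>T ?z) J \<cdot>\<^sub>A ((id\<^sub>V ?x \<boxtimes>\<^sub>T \<gamma>\<^sub>0 C D) \<boxtimes>\<^sub>S id\<^sub>A J)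
          \<cdot>\<^sub>A (\<gamma>\<^sub>0 B ?Q \<boxtimes>\<^sub>S id\<^sub>A J) \<cdot>\<^sub>A (L\<^sub>1 (\<gamma> B C D) \<boxtimes>\<^sub>S id\<^sub>A J) \<cdot>\<^sub>A \<eta> ?R"
    by (simp add: act_interchange_extend)
  also have "\<dots> = (id\<^sub>V ?x \<boxtimes>\<^sub>S m ?y ?z J) \<cdot>\<^sub>A (id\<^sub>V ?x \<boxtimes>\<^sub>S (\<gamma>\<^sub>0 C D \<boxtimes>\<^sub>S id\<^sub>A J)) \<cdot>\<^sub>A m ?x (L\<^sub>0 ?Q) J
          \<cdot>\<^sub>A (\<gamma>\<^sub>0 B ?Q \<boxtimes>\<^sub>S id\<^sub>A J) \<cdot>\<^sub>A (L\<^sub>1 (\<gamma> B C D) \<boxtimes>\<^sub>S id\<^sub>A J) \<cdot>\<^sub>A \<eta> ?R"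
    using mult_natural_extend[of "id\<^sub>V ?x" "\<gamma>\<^sub>0 C D" "id\<^sub>A J"
        "(\<gamma>\<^sub>0 B ?Q \<boxtimes>\<^sub>S id\<^sub>A J) \<cdot>\<^sub>A (L\<^sub>1 (\<gamma> B C D) \<boxtimes>\<^sub>S id\<^sub>A J) \<cdot>\<^sub>A \<eta> ?R"] by simp
  also have "\<dots> = (id\<^sub>V ?x \<boxtimes>\<^sub>S m ?y ?z J) \<cdot>\<^sub>A (id\<^sub>V ?x \<boxtimes>\<^sub>S (\<gamma>\<^sub>0 C D \<boxtimes>\<^sub>S id\<^sub>A J)) \<cdot>\<^sub>A
        (m ?x (L\<^sub>0 ?Q) J \<cdot>\<^sub>A (\<gamma>\<^sub>0 B ?Q \<boxtimes>\<^sub>S id\<^sub>A J) \<cdot>\<^sub>A \<eta> (?x \<otimes>\<^sub>S ?Q)) \<cdot>\<^sub>A \<gamma> B C D"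
    using eta_natural[of "\<gamma> B C D"] by simp
  also have "\<dots> = (id\<^sub>V ?x \<boxtimes>\<^sub>S (id\<^sub>V ?y \<boxtimes>\<^sub>S \<eta> D)) \<cdot>\<^sub>A \<gamma> B C D"
    by (simp only: ind_assoc_tilde_eta Obj_simps assms) (simp add: act_interchange_extend ind_assoc_tilde_eta)
  \<comment> \<open>This is the common value of both sides; from here on \<open>?q\<close> is built up.\<close>
  also have "\<dots> = \<gamma> B C (?z \<otimes>\<^sub>S J) \<cdot>\<^sub>A (id\<^sub>V (L\<^sub>0 ?P) \<boxtimes>\<^sub>S \<eta> D)"
    using ind_assoc_natural[of "id\<^sub>A B" "id\<^sub>A C" "\<eta> D"] by (simp add: adj.L.amap_Idn act_Idn)
  also have "\<dots> = m ?x ?y (?z \<otimes>\<^sub>S J) \<cdot>\<^sub>A (\<gamma>\<^sub>0 B C \<boxtimes>\<^sub>S (id\<^sub>V ?z \<boxtimes>\<^sub>S id\<^sub>A J))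
        \<cdot>\<^sub>A m (L\<^sub>0 ?P) ?z J \<cdot>\<^sub>A (\<gamma>\<^sub>0 ?P D \<boxtimes>\<^sub>S id\<^sub>A J) \<cdot>\<^sub>A \<eta> ?R"
    by (simp add: ind_assoc_tilde_eta act_Idn ind_assoc_def)
  also have "\<dots> = (m ?x ?y (?z \<otimes>\<^sub>S J) \<cdot>\<^sub>A m (?x \<otimes>\<^sub>T ?y) ?z J) \<cdot>\<^sub>A ((\<gamma>\<^sub>0 B C \<boxtimes>\<^sub>T id\<^sub>V ?z) \<boxtimes>\<^sub>S id\<^sub>A J)
        \<cdot>\<^sub>A (\<gamma>\<^sub>0 ?P D \<boxtimes>\<^sub>S id\<^sub>A J) \<cdot>\<^sub>A \<eta> ?R"
    using mult_natural_extend[of "\<gamma>\<^sub>0 B C" "id\<^sub>V ?z" "id\<^sub>A J" "(\<gamma>\<^sub>0 ?P D \<boxtimes>\<^sub>S id\<^sub>A J) \<cdot>\<^sub>A \<eta> ?R"] by simp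
  also have "\<dots> = ((id\<^sub>V ?x \<boxtimes>\<^sub>S m ?y ?z J) \<cdot>\<^sub>A m ?x (?y \<otimes>\<^sub>T ?z) J \<cdot>\<^sub>A (a ?x ?y ?z \<boxtimes>\<^sub>S id\<^sub>A J))
        \<cdot>\<^sub>A ((\<gamma>\<^sub>0 B C \<boxtimes>\<^sub>T id\<^sub>V ?z) \<boxtimes>\<^sub>S id\<^sub>A J) \<cdot>\<^sub>A (\<gamma>\<^sub>0 ?P D \<boxtimes>\<^sub>S id\<^sub>A J) \<cdot>\<^sub>A \<eta> ?R"
    by (simp only: act_pentagon Obj_simps assms J_Obj)
  also have "\<dots> = (id\<^sub>V ?x \<boxtimes>\<^sub>S m ?y ?z J) \<cdot>\<^sub>A m ?x (?y \<otimes>\<^sub>T ?z) J \<cdot>\<^sub>A (?q \<boxtimes>\<^sub>S id\<^sub>A J) \<cdot>\<^sub>A \<eta> ?R"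
    by (simp add: act_interchange_extend)
  finally have "m ?x (?y \<otimes>\<^sub>T ?z) J \<cdot>\<^sub>A (?p \<boxtimes>\<^sub>S id\<^sub>A J) \<cdot>\<^sub>A \<eta> ?R = m ?x (?y \<otimes>\<^sub>T ?z) J \<cdot>\<^sub>A (?q \<boxtimes>\<^sub>S id\<^sub>A J) \<cdot>\<^sub>A \<eta> ?R"
    by (rule act.iso_cancel_left[rotated]) (simp_all add: act_iso)
  then show "(?p \<boxtimes>\<^sub>S id\<^sub>A J) \<cdot>\<^sub>A \<eta> ?R = (?q \<boxtimes>\<^sub>S id\<^sub>A J) \<cdot>\<^sub>A \<eta> ?R"
    by (rule act.iso_cancel_left[rotated]) simp_all
qed simp_all

section \<open>The induced skew monoidal structure\<close>

lemma ind_tensor_simps [simp]: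
  "omap (ind_tensor S L) (B, C) = L\<^sub>0 B \<otimes>\<^sub>S C"
  "amap (ind_tensor S L) (f, g) = L\<^sub>1 f \<boxtimes>\<^sub>S g"
  by (simp_all add: ind_tensor_def)

lemma is_functor_ind_tensor: "is_functor (prod_cat A A) A (ind_tensor S L)"
proof -
  interpret AA: category "prod_cat A A"
    by (intro category_prod_cat act.category_axioms)
  show ?thesis
    by unfold_locales
       (auto simp: Hom_iff adj.L.amap_Idn adj.L.amap_Comp_Arr act_Idn act_interchange)
qed

text \<open>
  Moving both occurrences of \<open>m\<close> to the left exhibits the two sides as \<open>opmonoidal_assoc\<close> acting on
  \<open>E\<close>, followed by the two sides of the pentagon of the action.
\<close>

lemma ind_skew_pentagon:
  assumes [simp]: "B \<in> Obj A" "C \<in> Obj A" "D \<in> Obj A" "E \<in> Obj A"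
  shows "(id\<^sub>V (L\<^sub>0 B) \<boxtimes>\<^sub>S \<gamma> C D E) \<cdot>\<^sub>A \<gamma> B (L\<^sub>0 C \<otimes>\<^sub>S D) E \<cdot>\<^sub>A (L\<^sub>1 (\<gamma> B C D) \<boxtimes>\<^sub>S id\<^sub>A E)
       = \<gamma> B C (L\<^sub>0 D \<otimes>\<^sub>S E) \<cdot>\<^sub>A \<gamma> (L\<^sub>0 B \<otimes>\<^sub>S C) D E"
proof -
  let ?x = "L\<^sub>0 B" and ?y = "L\<^sub>0 C" and ?z = "L\<^sub>0 D"
  let ?P = "?x \<otimes>\<^sub>S C" and ?Q = "?y \<otimes>\<^sub>S D"
  have "(id\<^sub>V ?x \<boxtimes>\<^sub>S \<gamma> C D E) \<cdot>\<^sub>A \<gamma> B ?Q E \<cdot>\<^sub>A (L\<^sub>1 (\<gamma> B C D) \<boxtimes>\<^sub>S id\<^sub>A E)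
      = (id\<^sub>V ?x \<boxtimes>\<^sub>S m ?y ?z E) \<cdot>\<^sub>A (id\<^sub>V ?x \<boxtimes>\<^sub>S (\<gamma>\<^sub>0 C D \<boxtimes>\<^sub>S id\<^sub>A E)) \<cdot>\<^sub>A m ?x (L\<^sub>0 ?Q) E
          \<cdot>\<^sub>A (\<gamma>\<^sub>0 B ?Q \<boxtimes>\<^sub>S id\<^sub>A E) \<cdot>\<^sub>A (L\<^sub>1 (\<gamma> B C D) \<boxtimes>\<^sub>S id\<^sub>A E)"
    unfolding ind_assoc_def[of V T A S m J L \<eta> \<epsilon> C D E] ind_assoc_def[of V T A S m J L \<eta> \<epsilon> B ?Q E]
    by (simp add: act_interchange_extend)
  also have "\<dots> = (id\<^sub>V ?x \<boxtimes>\<^sub>S m ?y ?z E) \<cdot>\<^sub>A m ?x (?y \<otimes>\<^sub>T ?z) E \<cdot>\<^sub>A ((id\<^sub>V ?x \<boxtimes>\<^sub>T \<gamma>\<^sub>0 C D) \<boxtimes>\<^sub>S id\<^sub>A E)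
          \<cdot>\<^sub>A (\<gamma>\<^sub>0 B ?Q \<boxtimes>\<^sub>S id\<^sub>A E) \<cdot>\<^sub>A (L\<^sub>1 (\<gamma> B C D) \<boxtimes>\<^sub>S id\<^sub>A E)"
    using mult_natural_extend[of "id\<^sub>V ?x" "\<gamma>\<^sub>0 C D" "id\<^sub>A E"
        "(\<gamma>\<^sub>0 B ?Q \<boxtimes>\<^sub>S id\<^sub>A E) \<cdot>\<^sub>A (L\<^sub>1 (\<gamma> B C D) \<boxtimes>\<^sub>S id\<^sub>A E)"] by simp
  also have "\<dots> = (id\<^sub>V ?x \<boxtimes>\<^sub>S m ?y ?z E) \<cdot>\<^sub>A m ?x (?y \<otimes>\<^sub>T ?z) E
        \<cdot>\<^sub>A (((id\<^sub>V ?x \<boxtimes>\<^sub>T \<gamma>\<^sub>0 C D) \<cdot>\<^sub>V \<gamma>\<^sub>0 B ?Q \<cdot>\<^sub>V L\<^sub>1 (\<gamma> B C D)) \<boxtimes>\<^sub>S id\<^sub>A E)"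
    by (simp add: act_interchange)
  also have "\<dots> = ((id\<^sub>V ?x \<boxtimes>\<^sub>S m ?y ?z E) \<cdot>\<^sub>A m ?x (?y \<otimes>\<^sub>T ?z) E \<cdot>\<^sub>A (a ?x ?y ?z \<boxtimes>\<^sub>S id\<^sub>A E))
        \<cdot>\<^sub>A ((\<gamma>\<^sub>0 B C \<boxtimes>\<^sub>T id\<^sub>V ?z) \<boxtimes>\<^sub>S id\<^sub>A E) \<cdot>\<^sub>A (\<gamma>\<^sub>0 ?P D \<boxtimes>\<^sub>S id\<^sub>A E)"
    by (simp add: opmonoidal_assoc act_interchange)
  also have "\<dots> = m ?x ?y (?z \<otimes>\<^sub>S E) \<cdot>\<^sub>A m (?x \<otimes>\<^sub>T ?y) ?z E
        \<cdot>\<^sub>A ((\<gamma>\<^sub>0 B C \<boxtimes>\<^sub>T id\<^sub>V ?z) \<boxtimes>\<^sub>S id\<^sub>A E) \<cdot>\<^sub>A (\<gamma>\<^sub>0 ?P D \<boxtimes>\<^sub>S id\<^sub>A E)"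
    by (simp only: act_pentagon Obj_simps assms) simp
  also have "\<dots> = \<gamma> B C (?z \<otimes>\<^sub>S E) \<cdot>\<^sub>A \<gamma> ?P D E"
    using mult_natural_extend[of "\<gamma>\<^sub>0 B C" "id\<^sub>V ?z" "id\<^sub>A E" "\<gamma>\<^sub>0 ?P D \<boxtimes>\<^sub>S id\<^sub>A E"]
    by (simp add: ind_assoc_def act_Idn)
  finally show ?thesis .
qed

lemma ind_skew_lunit:
  assumes [simp]: "B \<in> Obj A" "C \<in> Obj A"
  shows "lu (L\<^sub>0 B \<otimes>\<^sub>S C) \<cdot>\<^sub>A \<gamma> J B C = L\<^sub>1 (lu B) \<boxtimes>\<^sub>S id\<^sub>A C"
proof -
  let ?x = "L\<^sub>0 B"
  have "lu (?x \<otimes>\<^sub>S C) \<cdot>\<^sub>A \<gamma> J B C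
      = u (?x \<otimes>\<^sub>S C) \<cdot>\<^sub>A (\<epsilon>\<^sub>0 \<boxtimes>\<^sub>S id\<^sub>A (?x \<otimes>\<^sub>S C)) \<cdot>\<^sub>A m (L\<^sub>0 J) ?x C \<cdot>\<^sub>A (\<gamma>\<^sub>0 J B \<boxtimes>\<^sub>S id\<^sub>A C)"
    by (simp add: ind_lunit_eq ind_assoc_def)
  also have "\<dots> = (u (?x \<otimes>\<^sub>S C) \<cdot>\<^sub>A m I ?x C) \<cdot>\<^sub>A ((\<epsilon>\<^sub>0 \<boxtimes>\<^sub>T id\<^sub>V ?x) \<boxtimes>\<^sub>S id\<^sub>A C) \<cdot>\<^sub>A (\<gamma>\<^sub>0 J B \<boxtimes>\<^sub>S id\<^sub>A C)"
    using mult_natural_extend[of \<epsilon>\<^sub>0 "id\<^sub>V ?x" "id\<^sub>A C" "\<gamma>\<^sub>0 J B \<boxtimes>\<^sub>S id\<^sub>A C"] by (simp add: act_Idn)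
  also have "\<dots> = (l ?x \<cdot>\<^sub>V (\<epsilon>\<^sub>0 \<boxtimes>\<^sub>T id\<^sub>V ?x) \<cdot>\<^sub>V \<gamma>\<^sub>0 J B) \<boxtimes>\<^sub>S id\<^sub>A C"
    by (simp only: act_lunit Obj_simps assms) (simp add: act_interchange)
  also have "\<dots> = L\<^sub>1 (lu B) \<boxtimes>\<^sub>S id\<^sub>A C"
    by (simp add: opmonoidal_lunit)
  finally show ?thesis .
qed

text \<open>
  By \<open>opmonoidal_runit\<close> the composite involving \<open>\<gamma>\<^sub>0\<close> and \<open>L \<eta>\<close> collapses to \<open>r\<close> acting on \<open>C\<close>, which
  leaves the triangle axiom of the action.
\<close>

lemma ind_skew_triangle:
  assumes [simp]: "B \<in> Obj A" "C \<in> Obj A"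
  shows "(id\<^sub>V (L\<^sub>0 B) \<boxtimes>\<^sub>S lu C) \<cdot>\<^sub>A \<gamma> B J C \<cdot>\<^sub>A (L\<^sub>1 (\<eta> B) \<boxtimes>\<^sub>S id\<^sub>A C) = id\<^sub>A (L\<^sub>0 B \<otimes>\<^sub>S C)"
proof -
  let ?x = "L\<^sub>0 B"
  have "(id\<^sub>V ?x \<boxtimes>\<^sub>S lu C) \<cdot>\<^sub>A \<gamma> B J C \<cdot>\<^sub>A (L\<^sub>1 (\<eta> B) \<boxtimes>\<^sub>S id\<^sub>A C)
      = (id\<^sub>V ?x \<boxtimes>\<^sub>S u C) \<cdot>\<^sub>A (id\<^sub>V ?x \<boxtimes>\<^sub>S (\<epsilon>\<^sub>0 \<boxtimes>\<^sub>S id\<^sub>A C)) \<cdot>\<^sub>A m ?x (L\<^sub>0 J) C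
          \<cdot>\<^sub>A (\<gamma>\<^sub>0 B J \<boxtimes>\<^sub>S id\<^sub>A C) \<cdot>\<^sub>A (L\<^sub>1 (\<eta> B) \<boxtimes>\<^sub>S id\<^sub>A C)"
    by (simp add: ind_lunit_eq ind_assoc_def act_interchange_extend)
  also have "\<dots> = (id\<^sub>V ?x \<boxtimes>\<^sub>S u C) \<cdot>\<^sub>A m ?x I C \<cdot>\<^sub>A ((id\<^sub>V ?x \<boxtimes>\<^sub>T \<epsilon>\<^sub>0) \<boxtimes>\<^sub>S id\<^sub>A C)
          \<cdot>\<^sub>A (\<gamma>\<^sub>0 B J \<boxtimes>\<^sub>S id\<^sub>A C) \<cdot>\<^sub>A (L\<^sub>1 (\<eta> B) \<boxtimes>\<^sub>S id\<^sub>A C)"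
    using mult_natural_extend[of "id\<^sub>V ?x" \<epsilon>\<^sub>0 "id\<^sub>A C"
        "(\<gamma>\<^sub>0 B J \<boxtimes>\<^sub>S id\<^sub>A C) \<cdot>\<^sub>A (L\<^sub>1 (\<eta> B) \<boxtimes>\<^sub>S id\<^sub>A C)"] by simp
  also have "\<dots> = (id\<^sub>V ?x \<boxtimes>\<^sub>S u C) \<cdot>\<^sub>A m ?x I C
        \<cdot>\<^sub>A (((id\<^sub>V ?x \<boxtimes>\<^sub>T \<epsilon>\<^sub>0) \<cdot>\<^sub>V \<gamma>\<^sub>0 B J \<cdot>\<^sub>V L\<^sub>1 (\<eta> B)) \<boxtimes>\<^sub>S id\<^sub>A C)"
    by (simp add: act_interchange)
  also have "\<dots> = id\<^sub>A (?x \<otimes>\<^sub>S C)"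
    by (simp add: opmonoidal_runit act_triangle)
  finally show ?thesis .
qed

lemma left_skew_monoidal_ind: "left_skew_monoidal A (ind_tensor S L) J \<gamma> lu \<eta>"
proof (intro left_skew_monoidal.intro left_skew_monoidal_axioms.intro)
  show "category A" by (rule act.category_axioms)
  show "is_functor (prod_cat A A) A (ind_tensor S L)" by (rule is_functor_ind_tensor)
next
  fix f g h B B' C C' D D'
  assume "f \<in> Hom A B B'" "g \<in> Hom A C C'" "h \<in> Hom A D D'"
  then show "\<gamma> B' C' D' \<cdot>\<^sub>A ((f \<boxtimes>\<^bsub>ind_tensor S L\<^esub> g) \<boxtimes>\<^bsub>ind_tensor S L\<^esub> h)
           = (f \<boxtimes>\<^bsub>ind_tensor S L\<^esub> (g \<boxtimes>\<^bsub>ind_tensor S L\<^esub> h)) \<cdot>\<^sub>A \<gamma> B C D"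
    using ind_assoc_natural[of f g h] by (auto simp: Hom_iff)
next
  fix f B B'
  assume "f \<in> Hom A B B'"
  then show "lu B' \<cdot>\<^sub>A (id\<^sub>A J \<boxtimes>\<^bsub>ind_tensor S L\<^esub> f) = f \<cdot>\<^sub>A lu B"
    and "\<eta> B' \<cdot>\<^sub>A f = (f \<boxtimes>\<^bsub>ind_tensor S L\<^esub> id\<^sub>A J) \<cdot>\<^sub>A \<eta> B"
    using ind_lunit_natural[of f] eta_natural[of f] by (auto simp: Hom_iff)
next
  show "lu J \<cdot>\<^sub>A \<eta> J = id\<^sub>A J" by (simp add: ind_lunit_eq counit0_eta)
next
  fix B C assume "B \<in> Obj A" "C \<in> Obj A"
  then show "\<gamma> B C J \<cdot>\<^sub>A \<eta> (B \<otimes>\<^bsub>ind_tensor S L\<^esub> C) = id\<^sub>A B \<boxtimes>\<^bsub>ind_tensor S L\<^esub> \<eta> C"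
    by (simp add: ind_assoc_def ind_assoc_tilde_eta adj.L.amap_Idn)
qed (simp_all add: Hom_iff adj.L.amap_Idn ind_skew_pentagon ind_skew_lunit ind_skew_triangle)

end

theorem theorem3p1:
  fixes V :: "('v, 'n) cat" and T :: "('v \<times> 'v, 'n \<times> 'n, 'v, 'n) fctr" and I :: 'v
    and a :: "'v \<Rightarrow> 'v \<Rightarrow> 'v \<Rightarrow> 'n" and l r :: "'v \<Rightarrow> 'n"
    and A :: "('o, 'm) cat" and S :: "('v \<times> 'o, 'n \<times> 'm, 'o, 'm) fctr"
    and m :: "'v \<Rightarrow> 'v \<Rightarrow> 'o \<Rightarrow> 'm" and u :: "'o \<Rightarrow> 'm"
    and J :: 'o and L :: "('o, 'm, 'v, 'n) fctr" and \<eta> :: "'o \<Rightarrow> 'm" and \<epsilon> :: "'v \<Rightarrow> 'n"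
  assumes "left_skew_monoidal V T I a l r"
    and "strong_left_action V T I a l r A S m u"
    and "J \<in> Obj A"
    and "adjunction A V L (act_on A S J) \<eta> \<epsilon>"
  shows "left_skew_monoidal A (ind_tensor S L) J
           (ind_assoc V T A S m J L \<eta> \<epsilon>) (ind_lunit I A S u J L \<epsilon>) \<eta>"
proof -
  interpret strong_left_action V T I a l r A S m u by fact
  interpret adjunction A V L "act_on A S J" \<eta> \<epsilon> by fact
  interpret action_with_orbit_adjoint V T I a l r A S m u J L \<eta> \<epsilon>
    using \<open>J \<in> Obj A\<close> by unfold_locales
  show ?thesis by (rule left_skew_monoidal_ind)
qed

end
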